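(* Let $p$ be an odd prime, $\Lambda=\mathbb{Z}[G(p,p-1)]$ and $1\le i,j\le p-1$. Then, with elements of $R(i)$ and $R(j)$ regarded as row vectors in $\mathbb{Z}^{p-1}$, \[ \mathrm{Hom}_{\Lambda}(R(i),R(j))=\begin{cases}\{\text{right multiplication by } nI_{p-1}\mid n\in\mathbb{Z}\}, & \text{if } i\ge j,\\ \{\text{right multiplication by } pnI_{p-1}\mid n\in\mathbb{Z}\}, & \text{if } i<j,\end{cases} \] where $I_{p-1}$ is the identity matrix of size $p-1$.
   Context: Modules are right modules. For an odd prime $p$, $G(p,p-1)=\langle x,y\mid x^p=1,\ y^{p-1}=1,\ yx=x^my\rangle$, where $m$ is an integer of multiplicative order $p-1$ modulo $p$, and $\Lambda=\mathbb{Z}[G(p,p-1)]$. Let $\mathcal{T}_{p-1}=\{(a_{i,j})\in M_{p-1}(\mathbb{Z})\mid a_{i,j}\in p\mathbb{Z}\text{ if }i>j\}$. There is a surjective ring homomorphism $\tilde\lambda:\Lambda\to\mathcal{T}_{p-1}$, realized as follows. Let $\zeta=e^{2\pi i/p}$ and let $\sigma$ be the automorphism of $\mathbb{Z}[\zeta]$ with $\sigma(\zeta)=\zeta^m$. Let $\Lambda$ act on the right on the ideal $(\zeta-1)\mathbb{Z}[\zeta]$ by $v\cdot x=v\zeta$, $v\cdot y=\sigma^{-1}(v)$; $\tilde\lambda(a)$ is the matrix of $v\mapsto v\cdot a$ acting on row vectors with respect to the $\mathbb{Z}$-basis $(\zeta-1)^j$, $1\le j\le p-1$. Then $\mathcal{T}_{p-1}$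 is a right $\Lambda$-module via $t\cdot a=t\,\tilde\lambda(a)$, and $R(i)$ denotes its $i$-th row, i.e. $R(i)=\{(r_1,\dots,r_{p-1})\in\mathbb{Z}^{p-1}\mid r_j\in p\mathbb{Z}\text{ for }j<i\}$, with $r\cdot a=r\,\tilde\lambda(a)$ for $r\in R(i)$, $a\in\Lambda$. *)

theory Defs
  imports
    "HOL-Library.Poly_Mapping"
    "HOL-Computational_Algebra.Polynomial"
    "HOL-Number_Theory.Number_Theory"
    "HOL-Algebra.QuotRing"
    "Jordan_Normal_Form.Matrix"
begin

section \<open>Groups given by generators and relations\<close>

text \<open>A word is a list of letters; the letter \<open>(g, True)\<close> stands for the generator \<open>g\<close> and
  \<open>(g, False)\<close> for its inverse.  The relations are pairs of words.\<close>

type_synonym 'g gword = "('g \<times> bool) list"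

inductive word_cong :: "('g gword \<times> 'g gword) set \<Rightarrow> 'g gword \<Rightarrow> 'g gword \<Rightarrow> bool"
  for rels :: "('g gword \<times> 'g gword) set" where
  refl: "word_cong rels u u"
| sym: "word_cong rels u v \<Longrightarrow> word_cong rels v u"
| trans: "word_cong rels u v \<Longrightarrow> word_cong rels v w \<Longrightarrow> word_cong rels u w"
| append: "word_cong rels u u' \<Longrightarrow> word_cong rels v v' \<Longrightarrow> word_cong rels (u @ v) (u' @ v')"
| cancel: "word_cong rels [(g, b), (g, \<not> b)] []"
| rel: "(u, v) \<in> rels \<Longrightarrow> word_cong rels u v"

definition word_class :: "('g gword \<times> 'g gword) set \<Rightarrow> 'g gword \<Rightarrow> 'g gword set" where
  "word_class rels u = {w. word_cong rels u w}"

definition presented_group :: "('g gword \<times> 'g gword) set \<Rightarrow> 'g gword set monoid" where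
  "presented_group rels =
     \<lparr> carrier = range (word_class rels),
       monoid.mult = (\<lambda>A B. \<Union>u\<in>A. \<Union>v\<in>B. word_class rels (u @ v)),
       one = word_class rels [] \<rparr>"

lemma word_class_eq_iff: "word_class rels u = word_class rels v \<longleftrightarrow> word_cong rels u v"
  unfolding word_class_def by (blast intro: word_cong.refl word_cong.sym word_cong.trans)

lemma presented_group_mult:
  "word_class rels u \<otimes>\<^bsub>presented_group rels\<^esub> word_class rels v = word_class rels (u @ v)"
proof -
  have "word_class rels (u' @ v') = word_class rels (u @ v)"
    if "u' \<in> word_class rels u" "v' \<in> word_class rels v" for u' v'
    using that unfolding word_class_eq_iff
    by (auto simp: word_class_def intro: word_cong.append word_cong.sym)
  moreover have "u \<in> word_class rels u" "v \<in> word_class rels v"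
    by (auto simp: word_class_def intro: word_cong.refl)
  ultimately have "(\<Union>u'\<in>word_class rels u. \<Union>v'\<in>word_class rels v. word_class rels (u' @ v')) =
      word_class rels (u @ v)"
    by blast
  then show ?thesis
    by (simp add: presented_group_def)
qed

lemma word_cong_inverse:
  "word_cong rels (map (\<lambda>(g, b). (g, \<not> b)) (rev u) @ u) []"
proof (induction u)
  case Nil
  show ?case by (simp add: word_cong.refl)
next
  case (Cons l u)
  obtain g b where l: "l = (g, b)" by (cases l)
  let ?i = "map (\<lambda>(g, b). (g, \<not> b)) (rev u)"
  have "word_cong rels [(g, \<not> b), (g, b)] []"
    using word_cong.cancel[of rels g "\<not> b"] by simp
  then have "word_cong rels (?i @ [(g, \<not> b), (g, b)] @ u) (?i @ [] @ u)"
    by (intro word_cong.append word_cong.refl)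
  then show ?case
    using Cons.IH l by (auto intro: word_cong.trans)
qed

lemma group_presented_group: "group (presented_group rels)"
proof (rule groupI)
  fix x assume "x \<in> carrier (presented_group rels)"
  then obtain u where u: "x = word_class rels u" by (auto simp: presented_group_def)
  show "\<exists>y\<in>carrier (presented_group rels). y \<otimes>\<^bsub>presented_group rels\<^esub> x = \<one>\<^bsub>presented_group rels\<^esub>"
  proof (rule bexI)
    show "word_class rels (map (\<lambda>(g, b). (g, \<not> b)) (rev u)) \<otimes>\<^bsub>presented_group rels\<^esub> x =
          \<one>\<^bsub>presented_group rels\<^esub>"
      unfolding u presented_group_mult using word_cong_inverse[of rels u]
      by (simp add: presented_group_def word_class_eq_iff)
    show "word_class rels (map (\<lambda>(g, b). (g, \<not> b)) (rev u)) \<in> carrier (presented_group rels)"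
      by (simp add: presented_group_def)
  qed
next
  show "\<one>\<^bsub>presented_group rels\<^esub> \<in> carrier (presented_group rels)"
    by (simp add: presented_group_def)
next
  fix x assume "x \<in> carrier (presented_group rels)"
  then obtain u where u: "x = word_class rels u" by (auto simp: presented_group_def)
  have "\<one>\<^bsub>presented_group rels\<^esub> = word_class rels []" by (simp add: presented_group_def)
  then show "\<one>\<^bsub>presented_group rels\<^esub> \<otimes>\<^bsub>presented_group rels\<^esub> x = x"
    by (simp add: u presented_group_mult)
next
  fix x y assume "x \<in> carrier (presented_group rels)" "y \<in> carrier (presented_group rels)"
  then obtain u v where "x = word_class rels u" "y = word_class rels v"
    by (auto simp: presented_group_def)
  then show "x \<otimes>\<^bsub>presented_group rels\<^esub> y \<in> carrier (presented_group rels)"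
    by (simp add: presented_group_mult) (simp add: presented_group_def)
next
  fix x y z
  assume "x \<in> carrier (presented_group rels)" "y \<in> carrier (presented_group rels)"
    "z \<in> carrier (presented_group rels)"
  then obtain u v w where "x = word_class rels u" "y = word_class rels v" "z = word_class rels w"
    by (auto simp: presented_group_def)
  then show "x \<otimes>\<^bsub>presented_group rels\<^esub> y \<otimes>\<^bsub>presented_group rels\<^esub> z =
             x \<otimes>\<^bsub>presented_group rels\<^esub> (y \<otimes>\<^bsub>presented_group rels\<^esub> z)"
    by (simp add: presented_group_mult)
qed

section \<open>The group \<open>G(p, p-1)\<close> and its integral group ring\<close>

datatype gen = Gen_x | Gen_y

text \<open>The word \<open>g\<^sup>k\<close> for an integer exponent, which may be negative.\<close>

definition gen_pow :: "'g \<Rightarrow> int \<Rightarrow> 'g gword" where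
  "gen_pow g k = replicate (nat \<bar>k\<bar>) (g, 0 \<le> k)"

definition G_rels :: "nat \<Rightarrow> int \<Rightarrow> (gen gword \<times> gen gword) set" where
  "G_rels p m =
     {(gen_pow Gen_x (int p), []),
      (gen_pow Gen_y (int p - 1), []),
      (gen_pow Gen_y 1 @ gen_pow Gen_x 1, gen_pow Gen_x m @ gen_pow Gen_y 1)}"

definition G :: "nat \<Rightarrow> int \<Rightarrow> gen gword set monoid" where
  "G p m = presented_group (G_rels p m)"

text \<open>Elements of the integral group ring are finitely supported functions to the integers
  (\<open>Poly_Mapping\<close>), with the convolution product written out because the group here
  is a record and not a type class instance.\<close>

definition int_group_ring :: "('g, 'b) monoid_scheme \<Rightarrow> ('g \<Rightarrow>\<^sub>0 int) ring" where
  "int_group_ring H =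
     \<lparr> carrier = {a. Poly_Mapping.keys a \<subseteq> carrier H},
       monoid.mult = (\<lambda>a b. \<Sum>g\<in>Poly_Mapping.keys a. \<Sum>h\<in>Poly_Mapping.keys b.
                 Poly_Mapping.single (g \<otimes>\<^bsub>H\<^esub> h) (Poly_Mapping.lookup a g * Poly_Mapping.lookup b h)),
       one = Poly_Mapping.single \<one>\<^bsub>H\<^esub> 1,
       ring.zero = 0,
       add = (+) \<rparr>"

definition Lambda :: "nat \<Rightarrow> int \<Rightarrow> (gen gword set \<Rightarrow>\<^sub>0 int) ring" where
  "Lambda p m = int_group_ring (G p m)"

section \<open>The action on the ideal generated by \<open>\<zeta> - 1\<close>\<close>

definition zeta :: "nat \<Rightarrow> complex" where
  "zeta p = exp (2 * of_real pi * \<i> / of_nat p)"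

definition Z_zeta :: "nat \<Rightarrow> complex ring" where
  "Z_zeta p =
     \<lparr> carrier = {poly (map_poly of_int f) (zeta p) | f :: int poly. True},
       monoid.mult = (*), one = 1, ring.zero = 0, add = (+) \<rparr>"

definition sigma :: "nat \<Rightarrow> int \<Rightarrow> complex \<Rightarrow> complex" where
  "sigma p m = (THE s. s \<in> extensional (carrier (Z_zeta p)) \<and>
                       s \<in> ring_iso (Z_zeta p) (Z_zeta p) \<and>
                       s (zeta p) = zeta p powi m)"

definition zeta_ideal :: "nat \<Rightarrow> complex set" where
  "zeta_ideal p = PIdl\<^bsub>Z_zeta p\<^esub> (zeta p - 1)"

fun letter_act :: "nat \<Rightarrow> int \<Rightarrow> complex \<Rightarrow> gen \<times> bool \<Rightarrow> complex" where
  "letter_act p m v (Gen_x, True) = v * zeta p"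
| "letter_act p m v (Gen_x, False) = v * inverse (zeta p)"
| "letter_act p m v (Gen_y, True) = inv_into (carrier (Z_zeta p)) (sigma p m) v"
| "letter_act p m v (Gen_y, False) = sigma p m v"

text \<open>\<open>foldl\<close> processes the leftmost letter first, as a right action requires.\<close>

definition word_act :: "nat \<Rightarrow> int \<Rightarrow> complex \<Rightarrow> gen gword \<Rightarrow> complex" where
  "word_act p m = foldl (letter_act p m)"

text \<open>On the ideal, the action of a word respects the defining relations of the group, so the
  choice of a representative is immaterial.\<close>

definition group_act :: "nat \<Rightarrow> int \<Rightarrow> complex \<Rightarrow> gen gword set \<Rightarrow> complex" where
  "group_act p m v g = word_act p m v (SOME w. w \<in> g)"

definition Lambda_act :: "nat \<Rightarrow> int \<Rightarrow> complex \<Rightarrow> (gen gword set \<Rightarrow>\<^sub>0 int) \<Rightarrow> complex" where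
  "Lambda_act p m v a =
     (\<Sum>g\<in>Poly_Mapping.keys a. of_int (Poly_Mapping.lookup a g) * group_act p m v g)"

section \<open>The homomorphism to \<open>(p-1) \<times> (p-1)\<close> matrices and the modules \<open>R(i)\<close>\<close>

text \<open>Row vectors are \<open>1 \<times> (p-1)\<close> matrices.  Matrix indices start at \<open>0\<close>, so the basis element
  \<open>(\<zeta> - 1)\<^sup>j\<close> corresponds to column \<open>j - 1\<close>.\<close>

definition zeta_coords :: "nat \<Rightarrow> complex \<Rightarrow> int mat" where
  "zeta_coords p v = (THE r. r \<in> carrier_mat 1 (p - 1) \<and>
                             v = (\<Sum>j = 1..p - 1. of_int (r $$ (0, j - 1)) * (zeta p - 1) ^ j))"

definition lambda_mat :: "nat \<Rightarrow> int \<Rightarrow> (gen gword set \<Rightarrow>\<^sub>0 int) \<Rightarrow> int mat" where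
  "lambda_mat p m a = (THE A. A \<in> carrier_mat (p - 1) (p - 1) \<and>
                          (\<forall>v\<in>zeta_ideal p. zeta_coords p (Lambda_act p m v a) = zeta_coords p v * A))"

definition T_mat :: "nat \<Rightarrow> int mat set" where
  "T_mat p = {A \<in> carrier_mat (p - 1) (p - 1).
                \<forall>i\<in>{1..p - 1}. \<forall>j\<in>{1..p - 1}. i > j \<longrightarrow> int p dvd A $$ (i - 1, j - 1)}"

definition R :: "nat \<Rightarrow> nat \<Rightarrow> int mat set" where
  "R p i = {r \<in> carrier_mat 1 (p - 1). \<forall>j\<in>{1..p - 1}. j < i \<longrightarrow> int p dvd r $$ (0, j - 1)}"

lemma R_eq_rows_T:
  assumes "1 \<le> i" "i \<le> p - 1"
  shows "R p i = {mat_of_row (row A (i - 1)) | A. A \<in> T_mat p}"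
proof (intro equalityI subsetI)
  fix r assume r: "r \<in> R p i"
  define A where "A = mat (p - 1) (p - 1) (\<lambda>(k, l). if k = i - 1 then r $$ (0, l) else 0)"
  have "A \<in> T_mat p"
    using r assms by (auto simp: A_def T_mat_def R_def)
  moreover have "r = mat_of_row (row A (i - 1))"
    using r assms by (intro eq_matI) (auto simp: A_def R_def)
  ultimately show "r \<in> {mat_of_row (row A (i - 1)) | A. A \<in> T_mat p}" by blast
next
  fix r assume "r \<in> {mat_of_row (row A (i - 1)) | A. A \<in> T_mat p}"
  then show "r \<in> R p i"
    using assms by (auto simp: T_mat_def R_def)
qed

definition R_act :: "nat \<Rightarrow> int \<Rightarrow> int mat \<Rightarrow> (gen gword set \<Rightarrow>\<^sub>0 int) \<Rightarrow> int mat" where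
  "R_act p m r a = r * lambda_mat p m a"

section \<open>Homomorphisms of right modules\<close>

text \<open>Maps are extensional on the domain, so that equality of homomorphisms is equality of
  functions.\<close>

definition right_Hom ::
  "('a, 'c) ring_scheme \<Rightarrow> 'm::plus set \<Rightarrow> ('m \<Rightarrow> 'a \<Rightarrow> 'm) \<Rightarrow>
     'n::plus set \<Rightarrow> ('n \<Rightarrow> 'a \<Rightarrow> 'n) \<Rightarrow> ('m \<Rightarrow> 'n) set" where
  "right_Hom S M actM N actN =
     {f \<in> M \<rightarrow>\<^sub>E N. (\<forall>u\<in>M. \<forall>v\<in>M. f (u + v) = f u + f v) \<and>
                    (\<forall>u\<in>M. \<forall>a\<in>carrier S. f (actM u a) = actN (f u) a)}"

definition Hom_Lambda :: "nat \<Rightarrow> int \<Rightarrow> nat \<Rightarrow> nat \<Rightarrow> (int mat \<Rightarrow> int mat) set" where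
  "Hom_Lambda p m i j = right_Hom (Lambda p m) (R p i) (R_act p m) (R p j) (R_act p m)"

end

theory Submission
  imports Defs "Jordan_Normal_Form.Char_Poly"
begin

text \<open>
  Under \<open>r \<mapsto> \<Sum>\<^sub>j r\<^sub>j \<pi>\<^sup>j\<close> with \<open>\<pi> = \<zeta> - 1\<close>, the module \<open>R(i)\<close> becomes the ideal \<open>\<pi>\<^sup>i \<int>[\<zeta>]\<close>, because
  \<open>p\<close> is \<open>\<pi>\<^sup>p\<^sup>-\<^sup>1\<close> up to a unit.  A \<open>\<Lambda>\<close>-homomorphism \<open>F : \<pi>\<^sup>i \<int>[\<zeta>] \<rightarrow> \<pi>\<^sup>j \<int>[\<zeta>]\<close> is
  \<open>\<int>[\<zeta>]\<close>-linear and commutes with \<open>\<sigma>\<close>.  Since \<open>p \<in> \<pi>\<^sup>i \<int>[\<zeta>]\<close> is fixed by \<open>\<sigma>\<close>, so is \<open>c = F(p)\<close>;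
  hence \<open>c\<close> is an integer in \<open>\<pi> \<int>[\<zeta>]\<close>, i.e. \<open>c = p n\<close>, and \<open>p F(v) = F(p v) = c v\<close> gives
  \<open>F(v) = n v\<close>.  If \<open>i < j\<close>, then \<open>n \<pi>\<^sup>i \<in> \<pi>\<^sup>j \<int>[\<zeta>]\<close> forces \<open>p\<close> to divide \<open>n\<close>.
\<close>

section \<open>The ideals generated by powers of \<open>\<zeta> - 1\<close>\<close>

abbreviation ipoly :: "int poly \<Rightarrow> complex \<Rightarrow> complex" where
  "ipoly f x \<equiv> poly (map_poly of_int f) x"

lemma ipoly_add: "ipoly (f + g) x = ipoly f x + ipoly g x"
  by (simp add: of_int_poly_hom.hom_add)

lemma ipoly_mult: "ipoly (f * g) x = ipoly f x * ipoly g x"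
  by (simp add: of_int_poly_hom.hom_mult)

lemma ipoly_uminus: "ipoly (- f) x = - ipoly f x"
  by (simp add: of_int_poly_hom.hom_uminus)

lemma ipoly_diff: "ipoly (f - g) x = ipoly f x - ipoly g x"
  by (simp add: of_int_poly_hom.hom_minus)

lemma ipoly_pCons: "ipoly (pCons a f) x = of_int a + x * ipoly f x"
  by (simp add: of_int_hom.map_poly_pCons_hom)

lemma ipoly_pcompose: "ipoly (pcompose f g) x = ipoly f (ipoly g x)"
  by (induction f) (simp_all add: pcompose_pCons ipoly_add ipoly_mult ipoly_pCons)

text \<open>The determinant trick: \<open>u\<close> is an eigenvalue of the integer matrix
  \<open>M\<close> with eigenvector \<open>v\<close>, hence a root of its monic characteristic
  polynomial.\<close>

lemma algebraic_int_if_int_span: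
  fixes v :: "nat \<Rightarrow> complex" and M :: "nat \<Rightarrow> nat \<Rightarrow> int"
  assumes span: "\<And>k. k < n \<Longrightarrow> u * v k = (\<Sum>l<n. of_int (M k l) * v l)"
    and nz: "l < n" "v l \<noteq> 0"
  shows "algebraic_int u"
proof -
  define A where "A = mat n n (\<lambda>(k, l). M k l)"
  define B :: "complex mat" where "B = of_int_hom.mat_hom A"
  have A: "A \<in> carrier_mat n n" and B: "B \<in> carrier_mat n n" by (auto simp: A_def B_def)
  have "B *\<^sub>v vec n v = u \<cdot>\<^sub>v vec n v"
    by (rule eq_vecI) (auto simp: A_def B_def scalar_prod_def span atLeast0LessThan)
  moreover have "vec n v \<noteq> 0\<^sub>v n"
    using nz by (metis index_vec index_zero_vec(1))
  ultimately have "eigenvalue B u"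
    unfolding eigenvalue_def eigenvector_def using B by (intro exI[of _ "vec n v"]) auto
  then have "poly (char_poly B) u = 0"
    using eigenvalue_root_char_poly[OF B] by simp
  moreover have "char_poly B = map_poly of_int (char_poly A)"
    unfolding B_def by (rule of_int_hom.char_poly_hom[OF A])
  ultimately show ?thesis
    using degree_monic_char_poly[OF A] by (auto simp: algebraic_int_altdef_ipoly)
qed

locale odd_prime =
  fixes p :: nat
  assumes prime: "prime p" and odd: "odd p"
begin

definition \<pi> :: complex where "\<pi> = zeta p - 1"

abbreviation Zz :: "complex set" where "Zz \<equiv> carrier (Z_zeta p)"

definition I :: "nat \<Rightarrow> complex set" where "I k = {\<pi> ^ k * x | x. x \<in> Zz}"

text \<open>Coordinates relative to the basis \<pi>, ..., \<pi>^(p-1) of \<open>I 1\<close>; values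
  of \<open>r\<close> outside \<open>{1..p - 1}\<close> do not count.\<close>

definition lin :: "(nat \<Rightarrow> int) \<Rightarrow> complex" where
  "lin r = (\<Sum>j = 1..p - 1. of_int (r j) * \<pi> ^ j)"

section \<open>Powers of \<zeta>\<close>

lemma p_gt2: "2 < p"
  using prime odd prime_ge_2_nat[of p] by (cases "p = 2") auto

lemma zeta_power: "zeta p ^ k = cis (2 * pi * k / p)"
proof -
  have "zeta p = cis (2 * pi / p)"
    by (simp add: zeta_def cis_conv_exp mult_ac)
  then show ?thesis by (simp add: DeMoivre mult_ac)
qed

lemma zeta_power_eq_1_iff: "zeta p ^ k = 1 \<longleftrightarrow> p dvd k"
proof -
  have "zeta p ^ k = 1 \<longleftrightarrow> cos (2 * pi * k / p) = 1"
    \<comment> \<open>A cosine equal to 1 forces the sine to vanish, so the real part alone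
      decides.\<close>
    unfolding zeta_power using sin_squared_eq[of "2 * pi * k / p"] by (auto simp: complex_eq_iff)
  also have "\<dots> \<longleftrightarrow> (\<exists>n::int. 2 * pi * k / p = n * 2 * pi)"
    by (rule cos_one_2pi_int)
  also have "\<dots> \<longleftrightarrow> (\<exists>n::int. real_of_int (int k) = real_of_int (int p * n))"
    using p_gt2 by (simp add: field_simps)
  also have "\<dots> \<longleftrightarrow> int p dvd int k"
    unfolding of_int_eq_iff by (simp add: dvd_def)
  finally show ?thesis by simp
qed

lemma zeta_pow_p: "zeta p ^ p = 1"
  by (simp add: zeta_power_eq_1_iff)

lemma zeta_nz: "zeta p \<noteq> 0"
  by (simp add: zeta_def)

lemma zeta_pow_cong: "[a = b] (mod p) \<Longrightarrow> zeta p ^ a = zeta p ^ b"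
  using zeta_pow_p p_gt2
  by (metis cong_def mod_mult_div_eq power_add power_mult power_one mult.right_neutral)

lemma inverse_zeta: "inverse (zeta p) = zeta p ^ (p - 1)"
  using zeta_pow_p p_gt2 by (metis inverse_unique power_minus_mult mult.commute zero_less_numeral order.strict_trans)

lemma pi_nz: "\<pi> \<noteq> 0"
  using zeta_power_eq_1_iff[of 1] p_gt2 by (auto simp: \<pi>_def)

section \<open>The ring generated by \<zeta> and its filtration by powers of \<pi>\<close>

lemma Zz_iff: "x \<in> Zz \<longleftrightarrow> (\<exists>f. x = ipoly f (zeta p))"
  by (auto simp: Z_zeta_def)

lemma ipoly_Zz: "ipoly f (zeta p) \<in> Zz"
  by (auto simp: Zz_iff)

lemma Zz_add: "x \<in> Zz \<Longrightarrow> y \<in> Zz \<Longrightarrow> x + y \<in> Zz"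
  unfolding Zz_iff by (metis ipoly_add)

lemma Zz_mult: "x \<in> Zz \<Longrightarrow> y \<in> Zz \<Longrightarrow> x * y \<in> Zz"
  unfolding Zz_iff by (metis ipoly_mult)

lemma Zz_uminus: "x \<in> Zz \<Longrightarrow> - x \<in> Zz"
  unfolding Zz_iff by (metis ipoly_uminus)

lemma Zz_of_int: "of_int a \<in> Zz"
  unfolding Zz_iff by (rule exI[of _ "[:a:]"]) (simp add: ipoly_pCons)

lemma Zz_0: "0 \<in> Zz" and Zz_1: "1 \<in> Zz"
  using Zz_of_int[of 0] Zz_of_int[of 1] by auto

lemma Zz_zeta: "zeta p \<in> Zz"
  unfolding Zz_iff by (rule exI[of _ "[:0, 1:]"]) (simp add: ipoly_pCons)

lemma Zz_power: "x \<in> Zz \<Longrightarrow> x ^ n \<in> Zz"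
  by (induction n) (auto simp: Zz_1 Zz_mult)

lemma Zz_pi: "\<pi> \<in> Zz"
  using Zz_add[OF Zz_zeta Zz_of_int[of "-1"]] by (simp add: \<pi>_def)

lemma I_0: "I 0 = Zz"
  by (auto simp: I_def)

lemma I_iff_pi: "\<pi> ^ k * x \<in> I k \<longleftrightarrow> x \<in> Zz"
  using pi_nz by (auto simp: I_def)

lemma I_add: "x \<in> I k \<Longrightarrow> y \<in> I k \<Longrightarrow> x + y \<in> I k"
  unfolding I_def by clarify (metis distrib_left Zz_add)

lemma I_mult: "x \<in> I k \<Longrightarrow> y \<in> Zz \<Longrightarrow> x * y \<in> I k"
  unfolding I_def by (auto simp: mult.assoc intro: Zz_mult)

lemma I_mult': "y \<in> Zz \<Longrightarrow> x \<in> I k \<Longrightarrow> y * x \<in> I k"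
  using I_mult by (simp add: mult.commute)

lemma I_0_mem: "0 \<in> I k"
  unfolding I_def using Zz_0 by force

lemma I_uminus: "x \<in> I k \<Longrightarrow> - x \<in> I k"
  using I_mult[of x k "of_int (-1)"] Zz_of_int[of "-1"] by simp

lemma I_diff: "x \<in> I k \<Longrightarrow> y \<in> I k \<Longrightarrow> x - y \<in> I k"
  using I_add[OF _ I_uminus] by simp

lemma I_sum: "(\<And>a. a \<in> A \<Longrightarrow> f a \<in> I k) \<Longrightarrow> sum f A \<in> I k"
  by (induction A rule: infinite_finite_induct) (auto simp: I_0_mem I_add)

lemma I_mult_I: "x \<in> I k \<Longrightarrow> y \<in> I l \<Longrightarrow> x * y \<in> I (k + l)"
proof -
  assume "x \<in> I k" "y \<in> I l"
  then obtain a b where "a \<in> Zz" "b \<in> Zz" "x = \<pi> ^ k * a" "y = \<pi> ^ l * b"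
    by (auto simp: I_def)
  then have "x * y = \<pi> ^ (k + l) * (a * b)" "a * b \<in> Zz"
    by (auto simp: power_add Zz_mult)
  then show ?thesis by (auto simp: I_def)
qed

lemma pi_power_I: "\<pi> ^ k \<in> I k"
  using I_iff_pi[of k 1] Zz_1 by simp

lemma I_mono: "l \<le> k \<Longrightarrow> x \<in> I k \<Longrightarrow> x \<in> I l"
proof -
  assume "l \<le> k" "x \<in> I k"
  then obtain y where y: "y \<in> Zz" "x = \<pi> ^ k * y" by (auto simp: I_def)
  have "\<pi> ^ k = \<pi> ^ l * \<pi> ^ (k - l)" using \<open>l \<le> k\<close> by (simp flip: power_add)
  then have "x = \<pi> ^ l * (\<pi> ^ (k - l) * y)" using y by (simp add: mult.assoc)
  moreover have "\<pi> ^ (k - l) * y \<in> Zz" by (intro Zz_mult Zz_power Zz_pi y)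
  ultimately show "x \<in> I l" by (auto simp: I_def)
qed

lemma I_imp_Zz: "x \<in> I k \<Longrightarrow> x \<in> Zz"
  using I_mono[of 0 k x] by (simp add: I_0)

text \<open>Binomial expansion of (\<pi> + 1)^p = \<zeta>^p = 1. It acts as an Eisenstein relation:
  every coefficient on the right is divisible by p.\<close>

lemma pi_power_p: "\<pi> ^ p = - (\<Sum>j = 1..p - 1. of_int (int (p choose j)) * \<pi> ^ j)"
proof -
  have "1 = (\<pi> + 1) ^ p" by (simp add: \<pi>_def zeta_pow_p)
  also have "\<dots> = (\<Sum>j\<le>p. of_nat (p choose j) * \<pi> ^ j)"
    by (simp add: binomial_ring)
  also have "{..p} = insert 0 (insert p {1..p - 1})" using p_gt2 by auto
  also have "(\<Sum>j\<in>\<dots>. of_nat (p choose j) * \<pi> ^ j)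
      = 1 + (\<pi> ^ p + (\<Sum>j = 1..p - 1. of_nat (p choose j) * \<pi> ^ j))"
    using p_gt2 by (subst sum.insert; (subst sum.insert)?) auto
  finally show ?thesis by (simp add: add_eq_0_iff)
qed

lemma dvd_choose: "j \<in> {1..p - 1} \<Longrightarrow> int p dvd int (p choose j)"
  using dvd_choose_prime[of j p] prime by auto

lemma lin_add: "lin r + lin s = lin (\<lambda>j. r j + s j)"
  by (simp add: lin_def sum.distrib algebra_simps)

lemma lin_smult: "of_int c * lin r = lin (\<lambda>j. c * r j)"
  by (simp add: lin_def sum_distrib_left algebra_simps)

lemma lin_cong: "(\<And>j. j \<in> {1..p - 1} \<Longrightarrow> r j = s j) \<Longrightarrow> lin r = lin s"
  by (simp add: lin_def)

lemma lin_single: "i \<in> {1..p - 1} \<Longrightarrow> lin (\<lambda>j. if j = i then 1 else 0) = \<pi> ^ i"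
proof -
  assume "i \<in> {1..p - 1}"
  then have "(\<Sum>j = 1..p - 1. if j = i then \<pi> ^ j else 0) = \<pi> ^ i" by (simp add: sum.delta)
  then show ?thesis unfolding lin_def
    by (smt (verit) sum.cong of_int_1 of_int_0 mult_1 mult_zero_left)
qed

text \<open>Multiplication by \<pi> shifts the coordinates by one; the overflow
  \<open>r (p - 1) * \<pi> ^ p\<close> is folded back by \<open>pi_power_p\<close>.\<close>

lemma pi_mult_lin:
  "\<pi> * lin r = lin (\<lambda>j. (if j = 1 then 0 else r (j - 1)) - int (p choose j) * r (p - 1))"
proof -
  have "\<pi> * lin r = (\<Sum>j = 1..p - 1. of_int (r j) * \<pi> ^ Suc j)"
    by (simp add: lin_def sum_distrib_left mult_ac)
  also have "\<dots> = (\<Sum>j = 2..p. of_int (r (j - 1)) * \<pi> ^ j)"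
    using p_gt2 by (intro sum.reindex_bij_witness[of _ "\<lambda>j. j - 1" Suc]) auto
  also have "{2..p} = insert p {2..p - 1}" using p_gt2 by auto
  also have "(\<Sum>j\<in>\<dots>. of_int (r (j - 1)) * \<pi> ^ j)
     = (\<Sum>j = 2..p - 1. of_int (r (j - 1)) * \<pi> ^ j) + of_int (r (p - 1)) * \<pi> ^ p"
    using p_gt2 by (subst sum.insert) auto
  also have "(\<Sum>j = 2..p - 1. of_int (r (j - 1)) * \<pi> ^ j)
      = (\<Sum>j = 1..p - 1. of_int (if j = 1 then 0 else r (j - 1)) * \<pi> ^ j)"
    using p_gt2 by (intro sum.mono_neutral_cong_left) auto
  finally show ?thesis
    unfolding pi_power_p lin_def
    by (simp add: sum_subtractf[symmetric] sum_distrib_left algebra_simps)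
qed

text \<open>The combinations with the required divisibility contain \<pi>^i and are closed under
  sums, integer multiples and multiplication by \<pi>. As \<zeta> = 1 + \<pi>, Horner evaluation
  then reaches every multiple of \<pi>^i.\<close>

lemma I_imp_lin:
  assumes "1 \<le> i" "i \<le> p - 1" "x \<in> I i"
  shows "\<exists>r. x = lin r \<and> (\<forall>j\<in>{1..p - 1}. j < i \<longrightarrow> int p dvd r j)"
proof -
  define S where "S = {lin r | r. \<forall>j\<in>{1..p - 1}. j < i \<longrightarrow> int p dvd r j}"
  have S_add: "x + y \<in> S" if "x \<in> S" "y \<in> S" for x y
    using that unfolding S_def by (force simp: lin_add)
  have S_smult: "of_int c * x \<in> S" if "x \<in> S" for x c
    using that unfolding S_def by (force simp: lin_smult)
  have S_pi: "\<pi> * x \<in> S" if x: "x \<in> S" for x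
  proof -
    obtain r where r: "x = lin r" "\<forall>j\<in>{1..p - 1}. j < i \<longrightarrow> int p dvd r j"
      using x by (auto simp: S_def)
    \<comment> \<open>The shift moves divisible coordinates to higher indices and puts 0 first; the
      folded term only adds multiples of p.\<close>
    let ?r = "\<lambda>j. (if j = 1 then 0 else r (j - 1)) - int (p choose j) * r (p - 1)"
    have "int p dvd ?r j" if j: "j \<in> {1..p - 1}" "j < i" for j
    proof (intro dvd_diff dvd_mult2 dvd_choose j)
      have "j - 1 \<in> {1..p - 1}" "j - 1 < i" if "j \<noteq> 1" using j that by auto
      then show "int p dvd (if j = 1 then 0 else r (j - 1))" using r(2) by auto
    qed
    then show ?thesis unfolding r(1) pi_mult_lin S_def by blast
  qed
  have "\<pi> ^ i * ipoly f (zeta p) \<in> S" for f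
  proof (induction f)
    case 0
    then show ?case using S_smult[of "\<pi> ^ i" 0] unfolding S_def
      by (force simp: lin_def intro!: exI[of _ "\<lambda>_. 0"])
  next
    case (pCons a f)
    have "\<pi> ^ i \<in> S"
      unfolding S_def using assms lin_single[of i] by (force intro!: exI[of _ "\<lambda>j. if j = i then 1 else 0"])
    moreover have "\<pi> ^ i * ipoly (pCons a f) (zeta p)
        = of_int a * \<pi> ^ i + (\<pi> ^ i * ipoly f (zeta p) + \<pi> * (\<pi> ^ i * ipoly f (zeta p)))"
      unfolding ipoly_pCons by (simp add: \<pi>_def algebra_simps)
    ultimately show ?case using S_add S_smult S_pi pCons.IH by metis
  qed
  then show ?thesis using assms(3) unfolding I_def Zz_iff S_def by blast
qed

text \<open>This is \<open>pi_power_p\<close> divided by \<pi>: the term j = 1 contributes p and the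
  terms j >= 2 together contribute p \<pi> s. It relates p to \<pi>^(p-1) without inverting 1 +
  \<pi> s.\<close>

lemma p_eq_pi_power:
  "\<exists>s\<in>Zz. of_nat p * (1 + \<pi> * s) = - (\<pi> ^ (p - 1))"
proof -
  define s where "s = (\<Sum>j = 2..p - 1. of_int (int (p choose j) div int p) * \<pi> ^ (j - 2))"
  have "s \<in> I 0" unfolding s_def
    by (intro I_sum) (auto simp: I_0 intro!: Zz_mult Zz_of_int Zz_power Zz_pi)
  have eq: "of_int (int (p choose j)) = (of_nat p * of_int (int (p choose j) div int p) :: complex)"
    if "j \<in> {1..p - 1}" for j
    using dvd_choose[OF that] by (metis dvd_mult_div_cancel of_int_mult of_int_of_nat_eq)
  have "\<pi> * \<pi> ^ (p - 1) = \<pi> ^ p" using p_gt2 by (simp flip: power_Suc)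
  also have "\<dots> = - (\<Sum>j = 1..p - 1. of_int (int (p choose j)) * \<pi> ^ j)" by (rule pi_power_p)
  also have "{1..p - 1} = insert 1 {2..p - 1}" using p_gt2 by auto
  also have "(\<Sum>j\<in>\<dots>. of_int (int (p choose j)) * \<pi> ^ j)
      = of_nat p * \<pi> + (\<Sum>j = 2..p - 1. of_int (int (p choose j)) * \<pi> ^ j)"
    by (subst sum.insert) auto
  also have "(\<Sum>j = 2..p - 1. of_int (int (p choose j)) * \<pi> ^ j)
      = (\<Sum>j = 2..p - 1. of_nat p * \<pi> * \<pi> * (of_int (int (p choose j) div int p) * \<pi> ^ (j - 2)))"
  proof (rule sum.cong, rule HOL.refl)
    fix j assume j: "j \<in> {2..p - 1}"
    then have "\<pi> ^ j = \<pi> * \<pi> * \<pi> ^ (j - 2)"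
      by (metis atLeastAtMost_iff le_add_diff_inverse power2_eq_square power_add)
    then show "of_int (int (p choose j)) * \<pi> ^ j
        = of_nat p * \<pi> * \<pi> * (of_int (int (p choose j) div int p) * \<pi> ^ (j - 2))"
      using eq[of j] j by simp
  qed
  finally have "\<pi> * \<pi> ^ (p - 1) = \<pi> * (- (of_nat p * (1 + \<pi> * s)))"
    by (simp add: s_def sum_distrib_left[symmetric] algebra_simps)
  then have "\<pi> ^ (p - 1) = - (of_nat p * (1 + \<pi> * s))"
    using pi_nz mult_left_cancel by blast
  then show ?thesis using \<open>s \<in> I 0\<close> I_0 by (intro bexI[of _ s]) auto
qed

text \<open>Bootstrapping: in p = - \<pi>^(p-1) - p \<pi> s, membership of p in \<open>I k\<close>
  puts the right side in \<open>I (k + 1)\<close>, as long as k + 1 <= p - 1.\<close>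

lemma p_in_I: "of_nat p \<in> I (p - 1)"
proof -
  obtain s where s: "s \<in> Zz" "of_nat p * (1 + \<pi> * s) = - (\<pi> ^ (p - 1))"
    using p_eq_pi_power by auto
  have "k \<le> p - 1 \<Longrightarrow> of_nat p \<in> I k" for k
  proof (induction k)
    case 0
    then show ?case using Zz_of_int[of "int p"] by (simp add: I_0)
  next
    case (Suc k)
    have "of_nat p * (\<pi> * s) \<in> I (k + 1)"
      using Suc pi_power_I[of 1] s by (intro I_mult_I I_mult) auto
    moreover have "\<pi> ^ (p - 1) \<in> I (k + 1)"
      using Suc.prems by (intro I_mono[OF _ pi_power_I]) auto
    ultimately have "- (\<pi> ^ (p - 1)) - of_nat p * (\<pi> * s) \<in> I (k + 1)"
      by (intro I_diff I_uminus)
    also have "- (\<pi> ^ (p - 1)) - of_nat p * (\<pi> * s) = of_nat p"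
      using s(2) by (simp add: algebra_simps)
    finally show ?case by simp
  qed
  then show ?thesis by simp
qed

text \<open>Multiplication by \<open>u\<close> preserves the ideal \<open>I 1\<close>, which is the
  integer span of \<pi>, ..., \<pi>^(p-1).\<close>

lemma Zz_algebraic_int:
  assumes "u \<in> Zz" shows "algebraic_int u"
proof -
  have "\<exists>r. u * \<pi> ^ Suc k = lin r" if "k < p - 1" for k
    using I_imp_lin[of 1 "u * \<pi> ^ Suc k"] I_mono[of 1 "Suc k"] p_gt2
      I_mult'[OF assms pi_power_I[of "Suc k"]] by auto
  then obtain M where M: "\<And>k. k < p - 1 \<Longrightarrow> u * \<pi> ^ Suc k = lin (M k)" by metis
  have "lin r = (\<Sum>l<p - 1. of_int (r (Suc l)) * \<pi> ^ Suc l)" for r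
    unfolding lin_def using p_gt2
    by (intro sum.reindex_bij_witness[of _ Suc "\<lambda>j. j - 1"]) auto
  then show ?thesis
    using M p_gt2 pi_nz
    by (intro algebraic_int_if_int_span[where v = "\<lambda>k. \<pi> ^ Suc k" and n = "p - 1" and l = 0
          and M = "\<lambda>k l. M k (Suc l)"]) auto
qed

section \<open>Integers in the ideal of \<pi>, and uniqueness of coordinates\<close>

lemma one_notin_I_1: "1 \<notin> I 1"
proof
  \<comment> \<open>If \<open>\<pi>\<close> were a unit, the relation \<open>p (1 + \<pi> s) = - \<pi>\<^sup>p\<^sup>-\<^sup>1\<close> would make \<open>1 / p\<close> an algebraic integer.\<close>
  assume "1 \<in> I 1"
  then obtain u where u: "u \<in> Zz" "\<pi> * u = 1" by (auto simp: I_def)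
  obtain s where s: "s \<in> Zz" "of_nat p * (1 + \<pi> * s) = - (\<pi> ^ (p - 1))"
    using p_eq_pi_power by auto
  define w where "w = - (1 + \<pi> * s) * u ^ (p - 1)"
  have w: "w \<in> Zz" unfolding w_def
    by (intro Zz_mult Zz_uminus Zz_add Zz_power Zz_1 Zz_pi u s)
  have "of_nat p * w = (\<pi> * u) ^ (p - 1)"
    unfolding w_def power_mult_distrib mult.assoc[symmetric]
    using s(2) by (metis minus_equation_iff mult_minus_right)
  then have "w = 1 / of_nat p" unfolding u using p_gt2 by (simp add: field_simps)
  then have "w \<in> \<rat>" by simp
  then have "w \<in> \<int>" using Zz_algebraic_int[OF w] rational_algebraic_int_is_int by blast
  then obtain z :: int where "w = of_int z" by (auto elim: Ints_cases)
  with \<open>w = 1 / of_nat p\<close> have "of_int (int p * z) = (of_int 1 :: complex)"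
    using p_gt2 by (simp add: field_simps)
  then have "int p * z = 1" by (simp only: of_int_eq_iff)
  then have "int p dvd 1" by (metis dvd_triv_left)
  with p_gt2 show False by simp
qed

text \<open>Both p and c lie in the ideal; if they were coprime, a Bezout combination would put 1
  there as well.\<close>

lemma of_int_I_1_iff: "of_int c \<in> I 1 \<longleftrightarrow> int p dvd c"
proof
  assume c: "of_int c \<in> I 1"
  show "int p dvd c"
  proof (rule ccontr)
    assume "\<not> int p dvd c"
    then have "coprime (int p) c" using prime by (intro prime_imp_coprime) auto
    then obtain a b where "a * int p + b * c = 1"
      by (metis bezout_int coprime_imp_gcd_eq_1)
    then have "of_int a * of_nat p + of_int b * of_int c = (1 :: complex)"
      by (metis of_int_1 of_int_add of_int_mult of_int_of_nat_eq)
    moreover have "of_nat p \<in> I 1" using I_mono[OF _ p_in_I] p_gt2 by simp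
    ultimately have "1 \<in> I 1"
      using I_add I_mult' Zz_of_int c by metis
    then show False using one_notin_I_1 by simp
  qed
next
  assume "int p dvd c"
  then obtain d where "c = int p * d" by auto
  moreover have "of_nat p * of_int d \<in> I 1"
    using I_mono[OF _ p_in_I, of 1] p_gt2 Zz_of_int by (intro I_mult) auto
  ultimately show "of_int c \<in> I 1" by simp
qed

text \<open>Strong induction on \<open>j\<close>. Modulo \<open>I (Suc j)\<close> only the j-th term
  can survive: earlier coefficients are divisible by p, which lies deep in the filtration, and later
  powers of \<pi> are high enough. Cancelling \<pi>^j puts \<open>r j\<close> in \<open>I 1\<close>.
  The bound \<open>i \<le> p\<close> lets \<open>lin_eq_0\<close> treat all coordinates at
  once.\<close>

lemma p_dvd_if_lin_in_I:
  assumes "lin r \<in> I i" "i \<le> p" "j \<in> {1..p - 1}" "j < i"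
  shows "int p dvd r j"
  using assms(3,4)
proof (induction j rule: less_induct)
  case (less j)
  have "of_int (r l) * \<pi> ^ l \<in> I (Suc j)" if l: "l \<in> {1..p - 1}" "l \<noteq> j" for l
  proof (cases "l < j")
    case True
    then have "int p dvd r l" using less l by auto
    then obtain d where "r l = int p * d" by auto
    then have "of_int (r l) * \<pi> ^ l = (of_nat p * \<pi> ^ l) * of_int d" by simp
    moreover have "of_nat p * \<pi> ^ l \<in> I (p - 1 + l)" by (intro I_mult_I p_in_I pi_power_I)
    moreover have "Suc j \<le> p - 1 + l" using less.prems l by auto
    ultimately show ?thesis using I_mono I_mult Zz_of_int by metis
  next
    case False
    with l have "\<pi> ^ l \<in> I (Suc j)" by (intro I_mono[OF _ pi_power_I]) auto
    then show ?thesis by (intro I_mult' Zz_of_int)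
  qed
  then have rest: "(\<Sum>l\<in>{1..p - 1} - {j}. of_int (r l) * \<pi> ^ l) \<in> I (Suc j)"
    by (intro I_sum) auto
  have "lin r \<in> I (Suc j)" using assms(1) less.prems by (intro I_mono[of "Suc j" i]) auto
  from I_diff[OF this rest] have "of_int (r j) * \<pi> ^ j \<in> I (Suc j)"
    unfolding lin_def using less.prems by (subst (asm) sum.remove[of _ j]) auto
  then obtain y where "y \<in> Zz" "of_int (r j) * \<pi> ^ j = \<pi> ^ j * (\<pi> * y)"
    by (auto simp: I_def mult_ac)
  then have "of_int (r j) = \<pi> ^ 1 * y" using pi_nz by simp
  then have "of_int (r j) \<in> I 1" using \<open>y \<in> Zz\<close> by (auto simp: I_def)
  then show ?case by (simp only: of_int_I_1_iff)
qed

text \<open>The right side is the condition that defines \<open>R p i\<close>, so this identifies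
  R(i) with the ideal \<open>I i\<close>.\<close>

lemma lin_in_I_iff:
  assumes "1 \<le> i" "i \<le> p - 1"
  shows "lin r \<in> I i \<longleftrightarrow> (\<forall>j\<in>{1..p - 1}. j < i \<longrightarrow> int p dvd r j)"
proof
  assume "lin r \<in> I i"
  then show "\<forall>j\<in>{1..p - 1}. j < i \<longrightarrow> int p dvd r j"
    using assms by (auto intro: p_dvd_if_lin_in_I)
next
  assume r: "\<forall>j\<in>{1..p - 1}. j < i \<longrightarrow> int p dvd r j"
  have "of_int (r j) * \<pi> ^ j \<in> I i" if j: "j \<in> {1..p - 1}" for j
  proof (cases "j < i")
    case True
    then have "int p dvd r j" using r j by blast
    then obtain d where "r j = int p * d" by (rule dvdE)
    then have "of_int (r j) * \<pi> ^ j = of_nat p * (of_int d * \<pi> ^ j)" by simp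
    moreover have "of_nat p \<in> I i" using assms by (intro I_mono[OF _ p_in_I]) auto
    ultimately show ?thesis using I_mult Zz_mult Zz_of_int Zz_power Zz_pi by metis
  next
    case False
    then have "\<pi> ^ j \<in> I i" by (intro I_mono[OF _ pi_power_I]) auto
    then show ?thesis by (intro I_mult' Zz_of_int)
  qed
  then show "lin r \<in> I i" unfolding lin_def by (intro I_sum)
qed

lemma lin_eq_0:
  assumes "lin r = 0" "j \<in> {1..p - 1}"
  shows "r j = 0"
proof -
  \<comment> \<open>All coefficients of a relation are divisible by \<open>p\<close>; dividing by \<open>p\<close> gives another relation.\<close>
  have "\<forall>j\<in>{1..p - 1}. int p ^ n dvd r j" if "lin r = 0" for n r
    using that
  proof (induction n arbitrary: r)
    case (Suc n)
    have dvd: "int p dvd r j" if "j \<in> {1..p - 1}" for j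
      using p_dvd_if_lin_in_I[of r p j] I_0_mem Suc.prems that by auto
    have "of_int (int p) * lin (\<lambda>j. r j div int p) = lin r"
      unfolding lin_smult by (rule lin_cong) (use dvd in auto)
    then have "lin (\<lambda>j. r j div int p) = 0" using Suc.prems p_gt2 by simp
    from Suc.IH[OF this] show ?case
      using dvd by (metis dvd_mult_div_cancel mult_dvd_mono dvd_refl power_Suc)
  qed simp
  \<comment> \<open>Since p^t exceeds t, the exponent t = |r j| gives a divisor larger than |r j|,
    which forces \<open>r j\<close> to be 0.\<close>
  then have "int p ^ nat \<bar>r j\<bar> dvd r j" using assms by blast
  moreover have "\<bar>r j\<bar> < int p ^ nat \<bar>r j\<bar>"
    using of_nat_less_iff[of "nat \<bar>r j\<bar>" "p ^ nat \<bar>r j\<bar>", where 'a = int]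
      power_gt_expt[of p "nat \<bar>r j\<bar>"] p_gt2 by simp
  ultimately show "r j = 0" using dvd_imp_le_int[of "r j"] by fastforce
qed

lemma lin_eq_iff: "lin r = lin s \<longleftrightarrow> (\<forall>j\<in>{1..p - 1}. r j = s j)"
proof
  assume eq: "lin r = lin s"
  have "lin (\<lambda>j. r j - s j) = lin r + of_int (-1) * lin s" unfolding lin_smult lin_add by simp
  then show "\<forall>j\<in>{1..p - 1}. r j = s j" using eq lin_eq_0[of "\<lambda>j. r j - s j"] by simp
qed (auto intro: lin_cong)

end

section \<open>The Galois action\<close>

lemma Z_zeta_simps:
  "monoid.mult (Z_zeta p) = (*)" "ring.add (Z_zeta p) = (+)" "monoid.one (Z_zeta p) = 1"
  by (simp_all add: Z_zeta_def)

section \<open>Polynomial values at the conjugates of \<zeta>\<close>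

lemma ipoly_sum: "ipoly (sum f A) x = (\<Sum>a\<in>A. ipoly (f a) x)"
  by (simp add: of_int_poly_hom.hom_sum poly_sum)

context odd_prime
begin

text \<open>Division with remainder by the cyclotomic polynomial 1 + x + ... + x^(p-1). One
  remainder serves all nontrivial p-th roots of unity at once.\<close>

lemma reduce_ipoly:
  "\<exists>r. degree r < p - 1 \<and> (\<forall>x. x ^ p = 1 \<longrightarrow> x \<noteq> 1 \<longrightarrow> ipoly f x = ipoly r x)"
proof -
  define \<Phi> :: "int poly" where "\<Phi> = (\<Sum>k<p. Polynomial.monom 1 k)"
  have coeff: "Polynomial.coeff \<Phi> n = (if n < p then 1 else 0)" for n
    unfolding \<Phi>_def by (simp add: coeff_sum)
  have deg: "degree \<Phi> = p - 1"
    using p_gt2 by (intro order.antisym degree_le le_degree) (auto simp: coeff)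
  have "\<Phi> \<noteq> 0" using coeff[of 0] p_gt2 by auto
  \<comment> \<open>Pseudo-division is ordinary division here because \<Phi> is monic.\<close>
  obtain q r where qr: "pseudo_divmod f \<Phi> = (q, r)" by force
  have "f = \<Phi> * q + r" and r: "r = 0 \<or> degree r < degree \<Phi>"
    using pseudo_divmod[OF \<open>\<Phi> \<noteq> 0\<close> qr] p_gt2 by (auto simp: deg coeff)
  moreover have "ipoly \<Phi> x = 0" if "x ^ p = 1" "x \<noteq> 1" for x
    using that power_diff_1_eq[of x p] by (simp add: \<Phi>_def ipoly_sum Polynomial.poly_monom)
  ultimately show ?thesis
    using deg p_gt2 by (intro exI[of _ r]) (auto simp: ipoly_add ipoly_mult)
qed

text \<open>Linear independence of 1, ..., \<zeta>^(p-2), reduced to \<open>lin_eq_0\<close>: the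
  substitution x + 1 passes from \<zeta> to \<pi>, and a factor \<pi> moves the exponents into the
  range from 1 to p - 1.\<close>

lemma ipoly_zeta_eq_0:
  assumes "degree r < p - 1" "ipoly r (zeta p) = 0"
  shows "r = 0"
proof -
  define s where "s = pcompose r [:1, 1:]"
  have deg: "degree s < p - 1" using assms(1) by (simp add: s_def degree_pcompose)
  have "\<pi> * ipoly s \<pi> = (\<Sum>i\<le>degree s. of_int (Polynomial.coeff s i) * \<pi> ^ Suc i)"
    by (simp add: poly_altdef sum_distrib_left mult_ac)
  also have "\<dots> = (\<Sum>i\<le>p - 2. of_int (Polynomial.coeff s i) * \<pi> ^ Suc i)"
    using deg by (intro sum.mono_neutral_left) (auto simp: coeff_eq_0)
  also have "\<dots> = lin (\<lambda>j. Polynomial.coeff s (j - 1))"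
    unfolding lin_def using p_gt2
    by (intro sum.reindex_bij_witness[of _ "\<lambda>j. j - 1" Suc]) auto
  finally have "lin (\<lambda>j. Polynomial.coeff s (j - 1)) = 0"
    using assms(2) by (simp add: s_def ipoly_pcompose ipoly_pCons \<pi>_def)
  from lin_eq_0[OF this, of "Suc _"] have "Polynomial.coeff s i = 0" if "i < p - 1" for i
    using that by force
  then have "Polynomial.coeff s i = 0" for i
    using deg by (cases "i < p - 1") (auto simp: coeff_eq_0)
  then have "s = 0" by (simp add: poly_eq_iff)
  then show ?thesis unfolding s_def by (simp add: pcompose_eq_0_iff)
qed

lemma zeta_power_root:
  assumes "\<not> p dvd k"
  shows "(zeta p ^ k) ^ p = 1" "zeta p ^ k \<noteq> 1"
  using assms zeta_power_eq_1_iff by (auto simp flip: power_mult)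

text \<open>The common remainder of \<open>f\<close> is zero because it vanishes at \<zeta>, so
  \<open>f\<close> vanishes at the other roots too. This makes the conjugation below well
  defined.\<close>

lemma ipoly_conj_eq_0:
  assumes "ipoly f (zeta p) = 0" "\<not> p dvd k"
  shows "ipoly f (zeta p ^ k) = 0"
proof -
  obtain r where r: "degree r < p - 1" "\<And>x. x ^ p = 1 \<Longrightarrow> x \<noteq> 1 \<Longrightarrow> ipoly f x = ipoly r x"
    using reduce_ipoly[of f] by blast
  have "\<not> p dvd 1" using p_gt2 by auto
  then have "r = 0"
    using assms(1) r zeta_power_root[of 1] by (intro ipoly_zeta_eq_0) auto
  then show ?thesis using r(2) zeta_power_root[OF assms(2)] by simp
qed

text \<open>After reduction, the polynomial minus \<open>c\<close> has degree below p - 1 but p - 1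
  distinct roots. It is therefore zero, and its constant coefficient shows that \<open>c\<close> is
  an integer.\<close>

lemma int_if_conj_equal:
  assumes "\<And>k. \<not> p dvd k \<Longrightarrow> ipoly f (zeta p ^ k) = c"
  shows "\<exists>n. c = of_int n"
proof -
  obtain r where r: "degree r < p - 1" "\<And>x. x ^ p = 1 \<Longrightarrow> x \<noteq> 1 \<Longrightarrow> ipoly f x = ipoly r x"
    using reduce_ipoly[of f] by blast
  define s where "s = map_poly of_int r - [:c:]"
  have "degree s < p - 1"
    using r(1) unfolding s_def by (intro degree_diff_less) auto
  have inj: "inj_on (\<lambda>k. zeta p ^ k) {1..p - 1}"
  proof (rule linorder_inj_onI')
    fix a b assume "a \<in> {1..p - 1}" "b \<in> {1..p - 1}" "a < b"
    then have "\<not> p dvd (b - a)" by (auto dest: dvd_imp_le)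
    moreover have "zeta p ^ b = zeta p ^ a * zeta p ^ (b - a)"
      using \<open>a < b\<close> by (simp flip: power_add)
    ultimately show "zeta p ^ a \<noteq> zeta p ^ b"
      using zeta_power_root(2) zeta_nz by (metis mult_cancel_left2 power_not_zero)
  qed
  have "s = 0"
  proof (rule ccontr)
    assume "s \<noteq> 0"
    have "poly s (zeta p ^ k) = 0" if "k \<in> {1..p - 1}" for k
    proof -
      have "\<not> p dvd k" using that by (auto dest: dvd_imp_le)
      then show ?thesis using assms[of k] r(2) zeta_power_root[of k] by (simp add: s_def)
    qed
    then have "(\<lambda>k. zeta p ^ k) ` {1..p - 1} \<subseteq> {x. poly s x = 0}" by auto
    from card_mono[OF poly_roots_finite[OF \<open>s \<noteq> 0\<close>] this]
    have "p - 1 \<le> card {x. poly s x = 0}" unfolding card_image[OF inj] by simp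
    also have "\<dots> \<le> degree s" by (rule card_poly_roots_bound[OF \<open>s \<noteq> 0\<close>])
    finally show False using \<open>degree s < p - 1\<close> by simp
  qed
  then have "Polynomial.coeff s 0 = 0" by simp
  then have "c = of_int (Polynomial.coeff r 0)" by (simp add: s_def)
  then show ?thesis by blast
qed

end

section \<open>The primitive root and the conjugation it defines\<close>

locale odd_prime_generator = odd_prime +
  fixes m :: int
  assumes ord: "ord (int p) m = p - 1"
begin

text \<open>A natural residue of \<open>m\<close>, so that \<open>zeta p powi m\<close> becomes an
  ordinary power.\<close>

definition k :: nat where "k = nat (m mod int p)"

lemma m_cong_k: "[m = int k] (mod int p)"
  using p_gt2 by (simp add: k_def cong_def)

lemma coprime_m: "coprime (int p) m"
  using ord p_gt2 unfolding ord_def by (auto split: if_splits)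

lemma coprime_k: "coprime p k"
proof -
  have "coprime (int p) (int k)"
    using coprime_m cong_imp_coprime[OF m_cong_k] by (simp add: coprime_commute)
  then show ?thesis by simp
qed

text \<open>The order is transferred from the integers to the naturals; p - 1 is the totient of p,
  so \<open>k\<close> generates all units modulo p.\<close>

lemma primroot_k: "residue_primroot p k"
proof -
  have "[m ^ d = 1] (mod int p) \<longleftrightarrow> [k ^ d = 1] (mod p)" for d
  proof -
    have "[m ^ d = int k ^ d] (mod int p)" by (rule cong_pow[OF m_cong_k])
    then have "[m ^ d = 1] (mod int p) \<longleftrightarrow> [int k ^ d = 1] (mod int p)"
      by (meson cong_sym cong_trans)
    also have "\<dots> \<longleftrightarrow> [k ^ d = 1] (mod p)"
      by (metis cong_int_iff of_nat_1 of_nat_power)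
    finally show ?thesis .
  qed
  then have "ord p k = ord (int p) m"
    unfolding ord_def using coprime_m coprime_k by simp
  then show ?thesis
    using ord prime coprime_k p_gt2 by (simp add: residue_primroot_def totient_prime)
qed

lemma k_power_cong: "[k ^ (p - 1) = 1] (mod p)"
  using primroot_k prime by (metis ord_divides dvd_refl residue_primroot_def totient_prime)

lemma not_dvd_k_power: "\<not> p dvd k ^ t"
proof
  assume "p dvd k ^ t"
  then have "p dvd k" using prime prime_dvd_power by blast
  then show False using coprime_k p_gt2 by (simp add: coprime_absorb_left)
qed

lemma zeta_powi_m: "zeta p powi m = zeta p ^ k"
proof -
  have "m = int k + int p * (m div int p)"
    using p_gt2 by (simp add: k_def)
  then have "zeta p powi m = zeta p powi int k * (zeta p powi int p) powi (m div int p)"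
    using zeta_nz by (metis power_int_add power_int_mult)
  then show ?thesis by (simp add: zeta_pow_p)
qed

text \<open>Every unit modulo p is a power of the primitive root, so the iterates of one conjugation
  reach all conjugates of \<zeta>.\<close>

lemma conj_power_eq:
  assumes "\<not> p dvd l"
  shows "\<exists>t. zeta p ^ l = zeta p ^ (k ^ t)"
proof -
  have "coprime p l" using prime assms by (rule prime_imp_coprime)
  then have "coprime (l mod p) p" using p_gt2 by (simp add: coprime_commute)
  moreover have "0 < l mod p" using assms by (simp add: mod_greater_zero_iff_not_dvd)
  moreover have "l mod p \<le> p" using p_gt2 by (simp add: less_imp_le)
  ultimately have "l mod p \<in> totatives p" by (simp add: totatives_def)
  also have "totatives p = (\<lambda>i. k ^ i mod p) ` {..<totient p}"
    using residue_primroot_is_generator[OF _ primroot_k] p_gt2 by (simp add: bij_betw_def)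
  finally obtain t where "l mod p = k ^ t mod p" by auto
  then show ?thesis by (metis zeta_pow_cong cong_def)
qed

text \<open>An explicit candidate for \<open>sigma p m\<close>: pick any representing polynomial and
  evaluate it at \<zeta>^k. The restriction to the ring matches the extensionality demanded of
  \<open>sigma\<close>.\<close>

definition conj1 :: "complex \<Rightarrow> complex" where
  "conj1 = (\<lambda>x\<in>Zz. ipoly (SOME f. x = ipoly f (zeta p)) (zeta p ^ k))"

lemma conj1_ipoly: "conj1 (ipoly f (zeta p)) = ipoly f (zeta p ^ k)"
proof -
  define g where "g = (SOME g. ipoly f (zeta p) = ipoly g (zeta p))"
  have "ipoly f (zeta p) = ipoly g (zeta p)"
    unfolding g_def by (rule someI) (rule HOL.refl)
  then have "ipoly (g - f) (zeta p ^ k) = 0"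
    using not_dvd_k_power[of 1] by (intro ipoly_conj_eq_0) (simp_all add: ipoly_diff)
  then show ?thesis
    by (simp add: conj1_def ipoly_Zz g_def ipoly_diff)
qed

lemma conj1_ipoly_power: "conj1 (ipoly f (zeta p ^ l)) = ipoly f (zeta p ^ (k * l))"
  using conj1_ipoly[of "pcompose f (Polynomial.monom 1 l)"]
  by (simp add: ipoly_pcompose Polynomial.poly_monom power_mult)

lemma conj1_funpow: "(conj1 ^^ t) (ipoly f (zeta p)) = ipoly f (zeta p ^ (k ^ t))"
proof (induction t)
  case (Suc t)
  then show ?case by (simp add: conj1_ipoly_power)
qed simp

lemma conj1_funpow_id: "x \<in> Zz \<Longrightarrow> (conj1 ^^ (p - 1)) x = x"
  using zeta_pow_cong[OF k_power_cong] by (auto simp: Zz_iff conj1_funpow)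

lemma conj1_Zz: "x \<in> Zz \<Longrightarrow> conj1 x \<in> Zz"
  using ipoly_Zz[of "pcompose _ (Polynomial.monom 1 k)"]
  by (auto simp: Zz_iff[of x] conj1_ipoly ipoly_pcompose Polynomial.poly_monom)

lemma conj1_funpow_Zz: "x \<in> Zz \<Longrightarrow> (conj1 ^^ t) x \<in> Zz"
  by (induction t) (auto simp: conj1_Zz)

text \<open>Since k^(p-1) is 1 modulo p, the (p-2)-nd iterate is a two-sided inverse.\<close>

lemma conj1_iso: "conj1 \<in> ring_iso (Z_zeta p) (Z_zeta p)"
proof -
  have p: "p - 1 = Suc (p - 2)" using p_gt2 by simp
  have "bij_betw conj1 Zz Zz"
  proof (rule bij_betwI[of _ _ _ "conj1 ^^ (p - 2)"])
    fix x assume x: "x \<in> Zz"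
    show "conj1 ((conj1 ^^ (p - 2)) x) = x" 
      using conj1_funpow_id[OF x] unfolding p by simp
    show "(conj1 ^^ (p - 2)) (conj1 x) = x"
      using conj1_funpow_id[OF x] unfolding p by (simp add: funpow_swap1)
  qed (auto simp: conj1_Zz conj1_funpow_Zz)
  moreover have "conj1 (x * y) = conj1 x * conj1 y" "conj1 (x + y) = conj1 x + conj1 y"
    if "x \<in> Zz" "y \<in> Zz" for x y
    using that unfolding Zz_iff by (auto simp: conj1_ipoly simp flip: ipoly_mult ipoly_add)
  moreover have "conj1 1 = 1"
    using conj1_ipoly[of 1] by simp
  ultimately show ?thesis
    unfolding ring_iso_def Ring.ring_hom_def using conj1_Zz by (auto simp: Z_zeta_simps)
qed

text \<open>Ring endomorphisms fix the integers, hence are determined by the image of \<zeta>. This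
  gives the uniqueness in the description of \<open>sigma\<close>.\<close>

lemma ring_hom_ipoly:
  assumes "s \<in> Ring.ring_hom (Z_zeta p) (Z_zeta p)"
  shows "s (ipoly f (zeta p)) = ipoly f (s (zeta p))"
proof -
  have add: "s (x + y) = s x + s y" and mult: "s (x * y) = s x * s y"
    if "x \<in> Zz" "y \<in> Zz" for x y
    using ring_hom_add[OF assms that] ring_hom_mult[OF assms that] by (simp_all add: Z_zeta_simps)
  have one: "s 1 = 1" using ring_hom_one[OF assms] by (simp add: Z_zeta_simps)
  have zero: "s 0 = 0" using add[OF Zz_0 Zz_0] by simp
  have neg: "s (- x) = - s x" if "x \<in> Zz" for x
    using add[OF that Zz_uminus[OF that]] zero by (simp add: eq_neg_iff_add_eq_0 add.commute)
  have nat: "s (of_nat n) = of_nat n" for n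
    using Zz_of_int[of "int _"] by (induction n) (simp_all add: zero one add Zz_1)
  have int: "s (of_int a) = of_int a" for a
    using Zz_of_int[of "int _"] by (cases a rule: int_cases2) (simp_all add: nat neg)
  show ?thesis
    by (induction f) (simp_all add: zero ipoly_pCons add mult int Zz_of_int Zz_mult Zz_zeta ipoly_Zz)
qed

abbreviation \<sigma> :: "complex \<Rightarrow> complex" where "\<sigma> \<equiv> sigma p m"

lemma sigma_eq: "\<sigma> = conj1"
  unfolding sigma_def
proof (rule the_equality)
  have "conj1 (zeta p) = zeta p ^ k" using conj1_ipoly[of "[:0, 1:]"] by (simp add: ipoly_pCons)
  then show "conj1 \<in> extensional Zz \<and> conj1 \<in> ring_iso (Z_zeta p) (Z_zeta p) \<and>
      conj1 (zeta p) = zeta p powi m"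
    using conj1_iso by (auto simp: zeta_powi_m conj1_def)
next
  fix s assume s: "s \<in> extensional Zz \<and> s \<in> ring_iso (Z_zeta p) (Z_zeta p) \<and>
      s (zeta p) = zeta p powi m"
  show "s = conj1"
  proof (rule extensionalityI[of _ Zz])
    fix x assume "x \<in> Zz"
    then obtain f where "x = ipoly f (zeta p)" by (auto simp: Zz_iff)
    then show "s x = conj1 x"
      using ring_hom_ipoly[of s f] s by (simp add: zeta_powi_m conj1_ipoly ring_iso_def)
  qed (use s in \<open>auto simp: conj1_def\<close>)
qed

section \<open>Properties of \<sigma> and of its inverse\<close>

lemma sigma_ipoly: "\<sigma> (ipoly f (zeta p)) = ipoly f (zeta p ^ k)"
  by (simp add: sigma_eq conj1_ipoly)

lemma sigma_zeta: "\<sigma> (zeta p) = zeta p ^ k"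
  using sigma_ipoly[of "[:0, 1:]"] by (simp add: ipoly_pCons)

lemma sigma_Zz: "x \<in> Zz \<Longrightarrow> \<sigma> x \<in> Zz"
  by (simp add: sigma_eq conj1_Zz)

lemma sigma_bij: "bij_betw \<sigma> Zz Zz"
  using conj1_iso by (simp add: sigma_eq ring_iso_def)

lemma sigma_add: "x \<in> Zz \<Longrightarrow> y \<in> Zz \<Longrightarrow> \<sigma> (x + y) = \<sigma> x + \<sigma> y"
  using conj1_iso by (auto simp: sigma_eq ring_iso_def Ring.ring_hom_def Z_zeta_simps)

lemma sigma_mult: "x \<in> Zz \<Longrightarrow> y \<in> Zz \<Longrightarrow> \<sigma> (x * y) = \<sigma> x * \<sigma> y"
  using conj1_iso by (auto simp: sigma_eq ring_iso_def Ring.ring_hom_def Z_zeta_simps)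

lemma sigma_of_int: "\<sigma> (of_int a) = of_int a"
  using sigma_ipoly[of "[:a:]"] by (simp add: ipoly_pCons)

lemma sigma_power: "x \<in> Zz \<Longrightarrow> \<sigma> (x ^ n) = \<sigma> x ^ n"
  using sigma_of_int[of 1] by (induction n) (simp_all add: sigma_mult Zz_power)

text \<open>Because \<zeta>^k - 1 is \<pi> times a geometric sum, \<sigma> sends \<pi> to a multiple
  of \<pi>.\<close>

lemma sigma_I: "x \<in> I j \<Longrightarrow> \<sigma> x \<in> I j"
proof -
  assume "x \<in> I j"
  then obtain y where y: "y \<in> Zz" "x = \<pi> ^ j * y" by (auto simp: I_def)
  have "\<sigma> \<pi> = \<pi> * (\<Sum>i<k. zeta p ^ i)"
    using sigma_ipoly[of "[:-1, 1:]"]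
    by (simp add: ipoly_pCons \<pi>_def power_diff_1_eq)
  then have "\<sigma> x = \<pi> ^ j * ((\<Sum>i<k. zeta p ^ i) ^ j * \<sigma> y)"
    using y by (simp add: sigma_mult sigma_power Zz_power Zz_pi power_mult_distrib)
  moreover have "(\<Sum>i<k. zeta p ^ i) \<in> Zz"
    using I_sum[of "{..<k}" "\<lambda>i. zeta p ^ i" 0] by (simp add: I_0 Zz_power Zz_zeta)
  ultimately show "\<sigma> x \<in> I j"
    using sigma_Zz[OF y(1)] by (simp add: I_iff_pi Zz_mult Zz_power)
qed

text \<open>A fixed element is fixed by all iterates, so a polynomial representing it at \<zeta>
  takes the same value at every conjugate, and \<open>int_if_conj_equal\<close> applies.\<close>

lemma sigma_fixed:
  assumes "x \<in> Zz" "\<sigma> x = x"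
  shows "\<exists>n. x = of_int n"
proof -
  obtain f where f: "x = ipoly f (zeta p)" using assms(1) by (auto simp: Zz_iff)
  have "(conj1 ^^ t) x = x" for t
    using assms(2) by (induction t) (simp_all add: sigma_eq)
  then have "ipoly f (zeta p ^ (k ^ t)) = x" for t
    using conj1_funpow[of t f] f by simp
  then have "ipoly f (zeta p ^ l) = x" if "\<not> p dvd l" for l
    using conj_power_eq[OF that] by metis
  then show ?thesis by (rule int_if_conj_equal)
qed

abbreviation \<tau> :: "complex \<Rightarrow> complex" where "\<tau> \<equiv> inv_into Zz \<sigma>"

lemma tau_sigma: "x \<in> Zz \<Longrightarrow> \<tau> (\<sigma> x) = x"
  using sigma_bij by (simp add: bij_betw_inv_into_left)

lemma sigma_tau: "x \<in> Zz \<Longrightarrow> \<sigma> (\<tau> x) = x"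
  using sigma_bij by (simp add: bij_betw_inv_into_right)

lemma tau_Zz: "x \<in> Zz \<Longrightarrow> \<tau> x \<in> Zz"
  using sigma_bij by (metis bij_betw_def inv_into_into)

lemma sigma_eqD: "x \<in> Zz \<Longrightarrow> y \<in> Zz \<Longrightarrow> \<sigma> x = \<sigma> y \<Longrightarrow> x = y"
  by (metis tau_sigma)

lemma tau_add: "x \<in> Zz \<Longrightarrow> y \<in> Zz \<Longrightarrow> \<tau> (x + y) = \<tau> x + \<tau> y"
  by (rule sigma_eqD) (simp_all add: tau_Zz Zz_add sigma_add sigma_tau)

lemma sigma_funpow_I: "x \<in> I j \<Longrightarrow> (\<sigma> ^^ t) x \<in> I j"
  by (induction t) (simp_all add: sigma_I)

lemma sigma_funpow_id: "x \<in> Zz \<Longrightarrow> (\<sigma> ^^ (p - 1)) x = x"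
  unfolding sigma_eq by (rule conj1_funpow_id)

text \<open>On the ring \<tau> agrees with the (p-2)-nd iterate of \<sigma>, which preserves the
  ideal.\<close>

lemma tau_I: "x \<in> I j \<Longrightarrow> \<tau> x \<in> I j"
proof -
  assume x: "x \<in> I j"
  have p: "p - 1 = Suc (p - 2)" using p_gt2 by simp
  have y: "(\<sigma> ^^ (p - 2)) x \<in> I j" by (rule sigma_funpow_I[OF x])
  moreover have "\<sigma> ((\<sigma> ^^ (p - 2)) x) = x"
    using sigma_funpow_id[OF I_imp_Zz[OF x]] unfolding p by simp
  ultimately show "\<tau> x \<in> I j" using tau_sigma I_imp_Zz by metis
qed

lemma sigma_funpow_tau: "x \<in> Zz \<Longrightarrow> (\<sigma> ^^ t) ((\<tau> ^^ t) x) = x"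
proof (induction t arbitrary: x)
  case (Suc t)
  have "(\<tau> ^^ t) x \<in> Zz" using Suc.prems by (induction t) (auto simp: tau_Zz)
  then have "\<sigma> (\<tau> ((\<tau> ^^ t) x)) = (\<tau> ^^ t) x" by (rule sigma_tau)
  moreover have "(\<sigma> ^^ Suc t) ((\<tau> ^^ Suc t) x) = (\<sigma> ^^ t) (\<sigma> (\<tau> ((\<tau> ^^ t) x)))"
    by (simp add: funpow_swap1)
  ultimately show ?case using Suc by simp
qed simp

lemma tau_funpow_id: "x \<in> Zz \<Longrightarrow> (\<tau> ^^ (p - 1)) x = x"
proof -
  assume x: "x \<in> Zz"
  have "(\<tau> ^^ t) x \<in> Zz" for t using x by (induction t) (auto simp: tau_Zz)
  then show ?thesis using sigma_funpow_tau[OF x] sigma_funpow_id by metis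
qed

end

section \<open>The action of the group ring\<close>

lemma word_act_Nil: "word_act p m v [] = v"
  by (simp add: word_act_def)

lemma word_act_Cons: "word_act p m v (l # u) = word_act p m (letter_act p m v l) u"
  by (simp add: word_act_def)

lemma word_act_append: "word_act p m v (u @ w) = word_act p m (word_act p m v u) w"
  by (simp add: word_act_def)

lemma word_act_x_power: "word_act p m v (gen_pow Gen_x a) = v * zeta p powi a"
proof -
  have "word_act p m v (replicate n (Gen_x, b)) = v * (if b then zeta p else inverse (zeta p)) ^ n"
    for n b
    by (induction n arbitrary: v) (cases b; simp add: word_act_Nil word_act_Cons mult_ac)+
  then show ?thesis by (simp add: gen_pow_def power_int_def)
qed

lemma word_act_y_power:
  "word_act p m v (gen_pow Gen_y (int n)) = (inv_into (carrier (Z_zeta p)) (sigma p m) ^^ n) v"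
  by (simp add: gen_pow_def)
    (induction n arbitrary: v; simp add: word_act_Nil word_act_Cons funpow_swap1)

lemma carrier_Lambda: "carrier (Lambda p m) = {a. Poly_Mapping.keys a \<subseteq> range (word_class (G_rels p m))}"
  by (simp add: Lambda_def int_group_ring_def G_def presented_group_def)

section \<open>Additive maps on the ideals and row vectors\<close>

context odd_prime
begin

lemma additive_of_int_mult:
  assumes add: "\<And>x y. x \<in> I l \<Longrightarrow> y \<in> I l \<Longrightarrow> g (x + y) = g x + (g y :: complex)"
    and x: "x \<in> I l"
  shows "g (of_int a * x) = of_int a * g x"
proof -
  have zero: "g 0 = 0" using add[OF I_0_mem I_0_mem] by simp
  have mem: "of_nat n * x \<in> I l" for n
    using I_mult'[OF Zz_of_int x, of "int n"] by simp
  have neg: "g (- y) = - g y" if "y \<in> I l" for y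
    using add[OF that I_uminus[OF that]] zero by (simp add: eq_neg_iff_add_eq_0 add.commute)
  have nat: "g (of_nat n * x) = of_nat n * g x" for n
    by (induction n) (simp_all add: zero add x mem distrib_right)
  show ?thesis
    by (cases a rule: int_cases2) (simp_all add: nat neg mem)
qed

lemma additive_lin:
  assumes add: "\<And>x y. x \<in> I 1 \<Longrightarrow> y \<in> I 1 \<Longrightarrow> g (x + y) = g x + (g y :: complex)"
  shows "g (lin r) = (\<Sum>j = 1..p - 1. of_int (r j) * g (\<pi> ^ j))"
proof -
  have mem: "of_int (r j) * \<pi> ^ j \<in> I 1" if "1 \<le> j" for j
    using that by (intro I_mult' Zz_of_int I_mono[OF _ pi_power_I]) auto
  have "g (\<Sum>j\<in>A. of_int (r j) * \<pi> ^ j) = (\<Sum>j\<in>A. of_int (r j) * g (\<pi> ^ j))"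
    if "finite A" "A \<subseteq> {1..p - 1}" for A
    using that
  proof (induction A rule: finite_induct)
    case empty
    show ?case using add[OF I_0_mem I_0_mem] by simp
  next
    case (insert j A)
    have "\<pi> ^ j \<in> I 1" using insert.prems by (intro I_mono[OF _ pi_power_I]) auto
    have "(\<Sum>j\<in>A. of_int (r j) * \<pi> ^ j) \<in> I 1"
      using insert.prems by (intro I_sum mem) auto
    then show ?case
      using insert mem[of j] additive_of_int_mult[OF add \<open>\<pi> ^ j \<in> I 1\<close>] by (simp add: add)
  qed
  then show ?thesis by (simp add: lin_def)
qed

text \<open>The isomorphism from row vectors onto \<open>I 1\<close>, inverse to
  \<open>zeta_coords p\<close>; the shift accounts for columns starting at 0.\<close>

definition row_lin :: "int mat \<Rightarrow> complex" where
  "row_lin r = lin (\<lambda>j. r $$ (0, j - 1))"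

lemma row_lin_add:
  "r \<in> carrier_mat 1 (p - 1) \<Longrightarrow> s \<in> carrier_mat 1 (p - 1) \<Longrightarrow>
    row_lin (r + s) = row_lin r + row_lin s"
  unfolding row_lin_def lin_add using p_gt2 by (intro lin_cong) auto

lemma row_lin_smult:
  "r \<in> carrier_mat 1 (p - 1) \<Longrightarrow> row_lin (r * (n \<cdot>\<^sub>m 1\<^sub>m (p - 1))) = of_int n * row_lin r"
proof -
  assume r: "r \<in> carrier_mat 1 (p - 1)"
  then have "r * (n \<cdot>\<^sub>m 1\<^sub>m (p - 1)) = n \<cdot>\<^sub>m r"
    using mult_smult_distrib[OF r one_carrier_mat] r by simp
  then show ?thesis
    unfolding row_lin_def lin_smult using r p_gt2 by (intro lin_cong) auto
qed

lemma row_lin_inj: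
  assumes "r \<in> carrier_mat 1 (p - 1)" "s \<in> carrier_mat 1 (p - 1)" "row_lin r = row_lin s"
  shows "r = s"
proof (rule eq_matI)
  fix a b assume "a < dim_row s" "b < dim_col s"
  then have "a = 0" "Suc b \<in> {1..p - 1}" using assms(2) by auto
  then show "r $$ (a, b) = s $$ (a, b)"
    using assms(3) unfolding row_lin_def lin_eq_iff by (metis diff_Suc_1)
qed (use assms in auto)

lemma row_lin_surj:
  assumes "x \<in> I 1" shows "\<exists>r\<in>carrier_mat 1 (p - 1). row_lin r = x"
proof -
  have "1 \<le> p - 1" using p_gt2 by simp
  then obtain c where "x = lin c" using I_imp_lin[of 1 x] assms by blast
  moreover have "row_lin (mat 1 (p - 1) (\<lambda>(a, b). c (Suc b))) = lin c"
    unfolding row_lin_def by (rule lin_cong) auto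
  ultimately show ?thesis by (metis mat_carrier)
qed

lemma row_lin_I_1: "row_lin r \<in> I 1"
  unfolding row_lin_def using p_gt2 by (subst lin_in_I_iff) auto

lemma R_iff:
  assumes "1 \<le> i" "i \<le> p - 1"
  shows "r \<in> R p i \<longleftrightarrow> r \<in> carrier_mat 1 (p - 1) \<and> row_lin r \<in> I i"
  using assms unfolding R_def row_lin_def by (auto simp: lin_in_I_iff)

lemma zeta_coords_row_lin:
  assumes "r \<in> carrier_mat 1 (p - 1)"
  shows "zeta_coords p (row_lin r) = r"
proof -
  have eq: "(\<Sum>j = 1..p - 1. of_int (s $$ (0, j - 1)) * (zeta p - 1) ^ j) = row_lin s" for s
    by (simp add: row_lin_def lin_def \<pi>_def)
  show ?thesis
    unfolding zeta_coords_def eq using assms row_lin_inj by (intro the_equality) auto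
qed

lemma zeta_ideal_eq: "zeta_ideal p = I 1"
  by (auto simp: zeta_ideal_def cgenideal_def I_def \<pi>_def Z_zeta_simps mult.commute)

end

section \<open>The action of \<Lambda> and its matrices\<close>

context odd_prime_generator
begin

lemma letter_act_I: "v \<in> I j \<Longrightarrow> letter_act p m v l \<in> I j"
  by (cases "(p, m, v, l)" rule: letter_act.cases)
    (auto simp: inverse_zeta sigma_I tau_I intro!: I_mult Zz_power Zz_zeta)

lemma letter_act_add:
  "v \<in> Zz \<Longrightarrow> w \<in> Zz \<Longrightarrow> letter_act p m (v + w) l = letter_act p m v l + letter_act p m w l"
  by (cases "(p, m, v, l)" rule: letter_act.cases) (auto simp: sigma_add tau_add distrib_right)

lemma word_act_I: "v \<in> I j \<Longrightarrow> word_act p m v u \<in> I j"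
  by (induction u arbitrary: v) (simp_all add: word_act_Nil word_act_Cons letter_act_I)

lemma word_act_Zz: "v \<in> Zz \<Longrightarrow> word_act p m v u \<in> Zz"
  using word_act_I[of v 0 u] by (simp add: I_0)

lemma letter_act_Zz: "v \<in> Zz \<Longrightarrow> letter_act p m v l \<in> Zz"
  using letter_act_I[of v 0 l] by (simp add: I_0)

lemma word_act_add:
  "v \<in> Zz \<Longrightarrow> w \<in> Zz \<Longrightarrow> word_act p m (v + w) u = word_act p m v u + word_act p m w u"
  by (induction u arbitrary: v w)
    (simp_all add: word_act_Nil word_act_Cons letter_act_Zz letter_act_add)

lemma word_act_rel:
  assumes "(u, w) \<in> G_rels p m" "v \<in> Zz"
  shows "word_act p m v u = word_act p m v w"
proof -
  have "word_act p m v (gen_pow Gen_x (int p)) = v"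
    by (simp add: word_act_x_power zeta_pow_p)
  moreover have "word_act p m v (gen_pow Gen_y (int p - 1)) = v"
    using word_act_y_power[of p m v "p - 1"] tau_funpow_id[OF assms(2)] p_gt2
    by (simp add: of_nat_diff)
  moreover have "word_act p m v (gen_pow Gen_y 1 @ gen_pow Gen_x 1)
      = word_act p m v (gen_pow Gen_x m @ gen_pow Gen_y 1)"
  proof -
    \<comment> \<open>Words act from left to right, so these are the two sides of y x = x^m y. They
      agree because \<sigma> sends both to \<open>v * zeta p ^ k\<close>.\<close>
    have "\<tau> v * zeta p = \<tau> (v * zeta p ^ k)"
      by (rule sigma_eqD) (use assms(2) in
        \<open>simp_all add: sigma_mult sigma_tau tau_Zz sigma_zeta Zz_mult Zz_zeta Zz_power\<close>)
    then show ?thesis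
      using word_act_y_power[of p m _ 1]
      by (simp add: word_act_append word_act_x_power zeta_powi_m)
  qed
  ultimately show ?thesis
    using assms(1) by (auto simp: G_rels_def word_act_Nil)
qed

lemma word_act_cong:
  assumes "word_cong (G_rels p m) u w" "v \<in> Zz"
  shows "word_act p m v u = word_act p m v w"
  using assms
proof (induction arbitrary: v rule: word_cong.induct)
  case (append u u' w w')
  then show ?case by (simp add: word_act_append word_act_Zz)
next
  case (cancel g b)
  then show ?case
    by (cases g; cases b) (simp_all add: word_act_Nil word_act_Cons sigma_tau tau_sigma zeta_nz)
qed (auto simp: word_act_rel)

text \<open>The representative chosen in \<open>group_act\<close> is congruent to \<open>u\<close>,
  and congruent words act equally on the ring.\<close>

lemma group_act_class:
  assumes "v \<in> Zz"
  shows "group_act p m v (word_class (G_rels p m) u) = word_act p m v u"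
proof -
  have "word_cong (G_rels p m) u (SOME w. w \<in> word_class (G_rels p m) u)"
    by (rule someI2[of _ u]) (auto simp: word_class_def intro: word_cong.refl)
  then show ?thesis unfolding group_act_def using word_act_cong assms by metis
qed

lemma Lambda_act_I:
  assumes "a \<in> carrier (Lambda p m)" "v \<in> I j"
  shows "Lambda_act p m v a \<in> I j"
  unfolding Lambda_act_def
proof (intro I_sum I_mult' Zz_of_int)
  fix g assume "g \<in> Poly_Mapping.keys a"
  then obtain u where "g = word_class (G_rels p m) u"
    using assms(1) by (auto simp: carrier_Lambda)
  then show "group_act p m v g \<in> I j"
    using assms(2) I_imp_Zz by (simp add: group_act_class word_act_I)
qed

lemma Lambda_act_add:
  assumes "a \<in> carrier (Lambda p m)" "v \<in> Zz" "w \<in> Zz"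
  shows "Lambda_act p m (v + w) a = Lambda_act p m v a + Lambda_act p m w a"
proof -
  have "group_act p m (v + w) g = group_act p m v g + group_act p m w g"
    if g: "g \<in> Poly_Mapping.keys a" for g
  proof -
    obtain u where "g = word_class (G_rels p m) u"
      using assms(1) g unfolding carrier_Lambda by blast
    then show ?thesis using assms by (simp add: group_act_class word_act_add Zz_add)
  qed
  then show ?thesis
    by (simp add: Lambda_act_def distrib_left sum.distrib)
qed

text \<open>Group elements inside the group ring; \<Lambda>-linearity tested on these recovers the
  action of single letters.\<close>

definition word_elt :: "gen gword \<Rightarrow> gen gword set \<Rightarrow>\<^sub>0 int" where
  "word_elt u = Poly_Mapping.single (word_class (G_rels p m) u) 1"

lemma word_elt_carrier: "word_elt u \<in> carrier (Lambda p m)"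
  by (simp add: word_elt_def carrier_Lambda)

lemma Lambda_act_word_elt: "v \<in> Zz \<Longrightarrow> Lambda_act p m v (word_elt u) = word_act p m v u"
  by (simp add: word_elt_def Lambda_act_def group_act_class)

lemma lambda_mat_exists:
  assumes a: "a \<in> carrier (Lambda p m)"
  shows "\<exists>A\<in>carrier_mat (p - 1) (p - 1).
    \<forall>r\<in>carrier_mat 1 (p - 1). row_lin (r * A) = Lambda_act p m (row_lin r) a"
proof -
  define g where "g = (\<lambda>v. Lambda_act p m v a)"
  have "\<exists>c. g (\<pi> ^ j) = lin c" if "1 \<le> j" for j
    using I_imp_lin[of 1 "g (\<pi> ^ j)"] Lambda_act_I[OF a I_mono[OF that pi_power_I]] p_gt2
    by (auto simp: g_def)
  then obtain c where c: "\<And>j. 1 \<le> j \<Longrightarrow> g (\<pi> ^ j) = lin (c j)" by metis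
  \<comment> \<open>Row s holds the coordinates of the image of \<pi>^(s+1); additivity extends
    agreement from the basis to all rows.\<close>
  define A where "A = mat (p - 1) (p - 1) (\<lambda>(s, t). c (Suc s) (Suc t))"
  have "row_lin (r * A) = g (row_lin r)" if r: "r \<in> carrier_mat 1 (p - 1)" for r
  proof -
    have entry: "(r * A) $$ (0, t - 1) = (\<Sum>j = 1..p - 1. r $$ (0, j - 1) * c j t)"
      if "t \<in> {1..p - 1}" for t
    proof -
      have "(r * A) $$ (0, t - 1) = (\<Sum>s = 0..<p - 1. r $$ (0, s) * c (Suc s) t)"
        using that r by (auto simp: A_def scalar_prod_def)
      also have "\<dots> = (\<Sum>j = 1..p - 1. r $$ (0, j - 1) * c j t)"
        by (intro sum.reindex_bij_witness[of _ "\<lambda>j. j - 1" Suc]) auto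
      finally show ?thesis .
    qed
    have "row_lin (r * A)
        = (\<Sum>t = 1..p - 1. \<Sum>j = 1..p - 1. of_int (r $$ (0, j - 1)) * (of_int (c j t) * \<pi> ^ t))"
      unfolding row_lin_def lin_def
      by (rule sum.cong, rule HOL.refl)
        (simp only: entry of_int_sum of_int_mult sum_distrib_right mult.assoc)
    also have "\<dots> = (\<Sum>j = 1..p - 1. of_int (r $$ (0, j - 1)) * lin (c j))"
      by (subst sum.swap) (simp add: lin_def sum_distrib_left)
    also have "\<dots> = (\<Sum>j = 1..p - 1. of_int (r $$ (0, j - 1)) * g (\<pi> ^ j))"
      by (intro sum.cong) (simp_all add: c)
    also have "\<dots> = g (row_lin r)"
      unfolding row_lin_def
      by (rule additive_lin[symmetric]) (simp add: g_def Lambda_act_add[OF a] I_imp_Zz)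
    finally show ?thesis .
  qed
  then show ?thesis by (intro bexI[of _ A]) (auto simp: A_def g_def)
qed

lemma
  assumes a: "a \<in> carrier (Lambda p m)"
  shows lambda_mat_carrier: "lambda_mat p m a \<in> carrier_mat (p - 1) (p - 1)"
    and row_lin_lambda_mat: "r \<in> carrier_mat 1 (p - 1) \<Longrightarrow>
      row_lin (r * lambda_mat p m a) = Lambda_act p m (row_lin r) a"
proof -
  \<comment> \<open>The condition defining \<open>lambda_mat\<close>, restated for rows instead of
    elements of the ideal.\<close>
  define P where "P = (\<lambda>A. A \<in> carrier_mat (p - 1) (p - 1) \<and>
    (\<forall>r\<in>carrier_mat 1 (p - 1). row_lin (r * A) = Lambda_act p m (row_lin r) a))"
  have P_eq: "P A \<longleftrightarrow> A \<in> carrier_mat (p - 1) (p - 1) \<and>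
    (\<forall>v\<in>zeta_ideal p. zeta_coords p (Lambda_act p m v a) = zeta_coords p v * A)" for A
  proof (cases "A \<in> carrier_mat (p - 1) (p - 1)")
    case A: True
    have "row_lin (r * A) = Lambda_act p m (row_lin r) a \<longleftrightarrow>
        zeta_coords p (Lambda_act p m (row_lin r) a) = zeta_coords p (row_lin r) * A"
      if r: "r \<in> carrier_mat 1 (p - 1)" for r
    proof -
      have "r * A \<in> carrier_mat 1 (p - 1)" using r A by simp
      moreover obtain s where s: "s \<in> carrier_mat 1 (p - 1)" "row_lin s = Lambda_act p m (row_lin r) a"
        using row_lin_surj Lambda_act_I[OF a row_lin_I_1] by metis
      ultimately show ?thesis
        using zeta_coords_row_lin[OF r] zeta_coords_row_lin[OF s(1)] row_lin_inj by metis
    qed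
    then have "(\<forall>r\<in>carrier_mat 1 (p - 1). row_lin (r * A) = Lambda_act p m (row_lin r) a) \<longleftrightarrow>
      (\<forall>v\<in>zeta_ideal p. zeta_coords p (Lambda_act p m v a) = zeta_coords p v * A)"
      unfolding zeta_ideal_eq using row_lin_surj row_lin_I_1 by metis
    then show ?thesis using A by (simp add: P_def)
  qed (simp add: P_def)
  have unique: "A = B" if "P A" "P B" for A B
  proof (rule eq_matI)
    have AB: "A \<in> carrier_mat (p - 1) (p - 1)" "B \<in> carrier_mat (p - 1) (p - 1)"
      using that by (auto simp: P_def)
    fix s t assume "s < dim_row B" "t < dim_col B"
    then have st: "s < p - 1" "t < p - 1" using AB by auto
    \<comment> \<open>A unit row extracts row \<open>s\<close>, so a matrix is determined by its
      action on rows.\<close>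
    define e :: "int mat" where "e = mat 1 (p - 1) (\<lambda>(_, l). if l = s then 1 else 0)"
    have e: "e \<in> carrier_mat 1 (p - 1)" by (simp add: e_def)
    have "e * A = e * B"
      using that e AB by (intro row_lin_inj) (auto simp: P_def)
    moreover have "(e * C) $$ (0, t) = C $$ (s, t)" if "C \<in> carrier_mat (p - 1) (p - 1)" for C
    proof -
      have "(e * C) $$ (0, t) = (\<Sum>l = 0..<p - 1. (if l = s then 1 else 0) * C $$ (l, t))"
        using that st by (auto simp: e_def scalar_prod_def)
      also have "\<dots> = (\<Sum>l = 0..<p - 1. if l = s then C $$ (l, t) else 0)"
        by (intro sum.cong) auto
      finally show ?thesis using st by simp
    qed
    ultimately show "A $$ (s, t) = B $$ (s, t)" using AB by metis
  qed (use that in \<open>auto simp: P_def\<close>)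
  obtain A where "P A" using lambda_mat_exists[OF a] by (auto simp: P_def)
  then have "lambda_mat p m a = A"
    unfolding lambda_mat_def P_eq[symmetric] using unique by (intro the_equality) auto
  with \<open>P A\<close> show "lambda_mat p m a \<in> carrier_mat (p - 1) (p - 1)"
    "r \<in> carrier_mat 1 (p - 1) \<Longrightarrow> row_lin (r * lambda_mat p m a) = Lambda_act p m (row_lin r) a"
    by (auto simp: P_def)
qed

section \<open>Homomorphisms over \<Lambda>\<close>

lemma R_act_R:
  assumes "a \<in> carrier (Lambda p m)" "1 \<le> i" "i \<le> p - 1" "r \<in> R p i"
  shows "R_act p m r a \<in> R p i" "row_lin (R_act p m r a) = Lambda_act p m (row_lin r) a"
  using assms lambda_mat_carrier[OF assms(1)] row_lin_lambda_mat[OF assms(1)] Lambda_act_I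
  by (auto simp: R_iff R_act_def)

lemma equivariant_scalar:
  assumes ij: "i \<le> p - 1" "1 \<le> j" "j \<le> p - 1"
    and maps: "\<And>v. v \<in> I i \<Longrightarrow> F v \<in> I j"
    and add: "\<And>v w. v \<in> I i \<Longrightarrow> w \<in> I i \<Longrightarrow> F (v + w) = F v + F w"
    and zeta: "\<And>v. v \<in> I i \<Longrightarrow> F (v * zeta p) = F v * zeta p"
    and sigma: "\<And>v. v \<in> I i \<Longrightarrow> F (\<sigma> v) = \<sigma> (F v)"
  shows "\<exists>n. (\<forall>v\<in>I i. F v = of_int n * v) \<and> (i < j \<longrightarrow> int p dvd n)"
proof -
  have of_int: "F (of_int a * v) = of_int a * F v" if "v \<in> I i" for a v
    using additive_of_int_mult[OF add that] .
  \<comment> \<open>Additivity and commutation with \<zeta> extend to the whole ring by Horner's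
    scheme.\<close>
  have Zz_mult: "F (v * x) = F v * x" if v: "v \<in> I i" and x: "x \<in> Zz" for v x
  proof -
    obtain f where x: "x = ipoly f (zeta p)" using x by (auto simp: Zz_iff)
    show ?thesis
      unfolding x using v
    proof (induction f arbitrary: v)
      case 0
      then show ?case using of_int[of v 0] by simp
    next
      case (pCons a f)
      have "v * zeta p * ipoly f (zeta p) \<in> I i" "of_int a * v \<in> I i"
        using pCons.prems by (simp_all add: I_mult I_mult' Zz_of_int Zz_zeta ipoly_Zz)
      moreover have "v * ipoly (pCons a f) (zeta p) = of_int a * v + v * zeta p * ipoly f (zeta p)"
        by (simp add: ipoly_pCons algebra_simps)
      ultimately have "F (v * ipoly (pCons a f) (zeta p))
          = of_int a * F v + F v * zeta p * ipoly f (zeta p)"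
        using pCons by (simp add: add of_int zeta I_mult Zz_zeta)
      then show ?case by (simp add: ipoly_pCons algebra_simps)
    qed
  qed
  have p: "of_nat p \<in> I i" by (rule I_mono[OF ij(1) p_in_I])
  have "\<sigma> (F (of_nat p)) = F (of_nat p)"
    using sigma[OF p] sigma_of_int[of "int p"] by simp
  then obtain c where c: "F (of_nat p) = of_int c"
    using sigma_fixed I_imp_Zz[OF maps[OF p]] by blast
  then have "of_int c \<in> I 1" using maps[OF p] I_mono[OF ij(2)] by metis
  then obtain n where n: "c = int p * n" by (auto simp only: of_int_I_1_iff)
  have scalar: "F v = of_int n * v" if v: "v \<in> I i" for v
  proof -
    \<comment> \<open>Both sides are F(p v): p is pulled out once as an integer scalar and once as
      the argument.\<close>
    have "of_nat p * F v = F (of_nat p) * v"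
      using Zz_mult[OF p I_imp_Zz[OF v]] of_int[OF v, of "int p"] by simp
    then show ?thesis using c n p_gt2 by simp
  qed
  moreover have "int p dvd n" if "i < j"
  proof -
    \<comment> \<open>The image of \<pi>^i lies in \<open>I j\<close>, at least one step deeper than
      \<open>I i\<close>; cancelling \<pi>^i leaves \<open>n\<close> in \<open>I 1\<close>.\<close>
    have "of_int n * \<pi> ^ i \<in> I (Suc i)"
      using maps[OF pi_power_I] scalar[OF pi_power_I] I_mono[of "Suc i" j] that by simp
    then obtain y where "y \<in> Zz" "of_int n * \<pi> ^ i = \<pi> ^ i * (\<pi> * y)"
      by (auto simp: I_def mult_ac)
    then have "of_int n \<in> I 1" using pi_nz I_iff_pi[of 1 y] by simp
    then show ?thesis by (simp only: of_int_I_1_iff)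
  qed
  ultimately show ?thesis by blast
qed

lemma Hom_Lambda_scalar:
  assumes ij: "1 \<le> i" "i \<le> p - 1" "1 \<le> j" "j \<le> p - 1" and f: "f \<in> Hom_Lambda p m i j"
  shows "\<exists>n. f = (\<lambda>r\<in>R p i. r * (n \<cdot>\<^sub>m 1\<^sub>m (p - 1))) \<and> (i < j \<longrightarrow> int p dvd n)"
proof -
  note Ri = R_iff[OF ij(1,2)] and Rj = R_iff[OF ij(3,4)]
  have f_ext: "f \<in> extensional (R p i)" and f_R: "r \<in> R p i \<Longrightarrow> f r \<in> R p j"
    and f_add: "r \<in> R p i \<Longrightarrow> s \<in> R p i \<Longrightarrow> f (r + s) = f r + f s"
    and f_act: "r \<in> R p i \<Longrightarrow> a \<in> carrier (Lambda p m) \<Longrightarrow> f (R_act p m r a) = R_act p m (f r) a"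
    for r s a
    using f by (auto simp: Hom_Lambda_def right_Hom_def PiE_def)
  \<comment> \<open>The map \<open>f\<close> transported from rows to ideals, where
    \<open>equivariant_scalar\<close> applies.\<close>
  define F where "F v = row_lin (f (zeta_coords p v))" for v
  have F: "F (row_lin r) = row_lin (f r)" if "r \<in> R p i" for r
    using that by (simp add: F_def zeta_coords_row_lin Ri)
  have ex: "\<exists>r\<in>R p i. v = row_lin r" if "v \<in> I i" for v
    using row_lin_surj[OF I_mono[OF ij(1) that]] that by (auto simp: Ri)
  have F_I: "F v \<in> I j" if v: "v \<in> I i" for v
    using ex[OF v] F f_R by (auto simp: Rj)
  have F_add: "F (v + w) = F v + F w" if v: "v \<in> I i" and w: "w \<in> I i" for v w
  proof -
    obtain r s where rs: "r \<in> R p i" "v = row_lin r" "s \<in> R p i" "w = row_lin s"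
      using ex v w by metis
    have eq: "v + w = row_lin (r + s)" using rs by (simp add: row_lin_add Ri)
    have "r + s \<in> R p i"
      using rs v w eq[symmetric] by (simp add: Ri I_add)
    moreover have "row_lin (f r + f s) = row_lin (f r) + row_lin (f s)"
      using f_R[OF rs(1)] f_R[OF rs(3)] by (intro row_lin_add) (auto simp: Rj)
    ultimately show ?thesis using eq rs by (simp add: F f_add)
  qed
  have F_act: "F (word_act p m v u) = word_act p m (F v) u" if v: "v \<in> I i" for v u
  proof -
    obtain r where r: "r \<in> R p i" "v = row_lin r" using ex[OF v] by blast
    note e = word_elt_carrier[of u]
    have "F (word_act p m v u) = F (row_lin (R_act p m r (word_elt u)))"
      using R_act_R(2)[OF e ij(1,2) r(1)] Lambda_act_word_elt[OF I_imp_Zz[OF v]] r(2) by simp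
    also have "\<dots> = row_lin (R_act p m (f r) (word_elt u))"
      using F[OF R_act_R(1)[OF e ij(1,2) r(1)]] f_act[OF r(1) e] by simp
    also have "\<dots> = word_act p m (F v) u"
      using R_act_R(2)[OF e ij(3,4) f_R[OF r(1)]] Lambda_act_word_elt[OF I_imp_Zz[OF F_I[OF v]]]
        F[OF r(1)] r(2) by simp
    finally show ?thesis .
  qed
  have "\<exists>n. (\<forall>v\<in>I i. F v = of_int n * v) \<and> (i < j \<longrightarrow> int p dvd n)"
    \<comment> \<open>The letter x gives multiplication by \<zeta>; the inverse of y is taken
      because it acts as \<sigma> itself.\<close>
    using F_act[of _ "[(Gen_x, True)]"] F_act[of _ "[(Gen_y, False)]"]
    by (intro equivariant_scalar ij F_I F_add) (simp_all add: word_act_Nil word_act_Cons)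
  then obtain n where n: "\<And>v. v \<in> I i \<Longrightarrow> F v = of_int n * v" "i < j \<longrightarrow> int p dvd n"
    by blast
  have "f = (\<lambda>r\<in>R p i. r * (n \<cdot>\<^sub>m 1\<^sub>m (p - 1)))"
  proof (rule extensionalityI[OF f_ext])
    fix r assume r: "r \<in> R p i"
    then have "row_lin (f r) = row_lin (r * (n \<cdot>\<^sub>m 1\<^sub>m (p - 1)))"
      using n(1)[of "row_lin r"] F[OF r] row_lin_smult[of r n] by (simp add: Ri)
    then have "f r = r * (n \<cdot>\<^sub>m 1\<^sub>m (p - 1))"
      using r f_R[OF r] by (intro row_lin_inj) (auto simp: Ri Rj)
    then show "f r = (\<lambda>r\<in>R p i. r * (n \<cdot>\<^sub>m 1\<^sub>m (p - 1))) r" using r by simp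
  qed simp
  then show ?thesis using n(2) by blast
qed

text \<open>Scalar matrices commute with the action. The image lies in the right module since
  \<open>I i\<close> is contained in \<open>I j\<close> when i >= j, while for i < j the factor p of
  \<open>n\<close> already lies in \<open>I j\<close>.\<close>

lemma scalar_in_Hom_Lambda:
  assumes ij: "1 \<le> i" "i \<le> p - 1" "1 \<le> j" "j \<le> p - 1" and n: "i < j \<longrightarrow> int p dvd n"
  shows "(\<lambda>r\<in>R p i. r * (n \<cdot>\<^sub>m 1\<^sub>m (p - 1))) \<in> Hom_Lambda p m i j"
proof -
  note Ri = R_iff[OF ij(1,2)] and Rj = R_iff[OF ij(3,4)]
  let ?N = "n \<cdot>\<^sub>m 1\<^sub>m (p - 1) :: int mat"
  have carr: "r * ?N \<in> carrier_mat 1 (p - 1)" if "r \<in> R p i" for r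
    using that by (auto simp: Ri)
  have "of_int n * v \<in> I j" if v: "v \<in> I i" for v
  proof (cases "i < j")
    case True
    then have "int p dvd n" using n by simp
    then obtain d where "n = int p * d" by (rule dvdE)
    then have "of_int n * v = of_nat p * (of_int d * v)" by simp
    moreover have "of_nat p \<in> I j" by (rule I_mono[OF ij(4) p_in_I])
    ultimately show ?thesis using I_mult Zz_mult Zz_of_int I_imp_Zz[OF v] by metis
  next
    case False
    then show ?thesis using I_mono[OF _ v] by (intro I_mult' Zz_of_int) auto
  qed
  then have maps: "r * ?N \<in> R p j" if "r \<in> R p i" for r
    using that carr[OF that] row_lin_smult[of r n] by (simp add: Ri Rj)
  have add: "r + s \<in> R p i \<and> (r + s) * ?N = r * ?N + s * ?N" if "r \<in> R p i" "s \<in> R p i" for r s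
    using that add_mult_distrib_mat[of r 1 "p - 1" s ?N "p - 1"]
    by (simp add: Ri row_lin_add I_add)
  have act: "R_act p m r a * ?N = R_act p m (r * ?N) a"
    if "r \<in> R p i" "a \<in> carrier (Lambda p m)" for r a
  proof -
    have r: "r \<in> carrier_mat 1 (p - 1)" using that by (simp add: Ri)
    note A = lambda_mat_carrier[OF that(2)]
    have "r * lambda_mat p m a * ?N = n \<cdot>\<^sub>m (r * lambda_mat p m a)"
      using mult_smult_distrib[of "r * lambda_mat p m a" 1 "p - 1" "1\<^sub>m (p - 1)" "p - 1" n] r A by simp
    also have "\<dots> = (n \<cdot>\<^sub>m r) * lambda_mat p m a"
      using mult_smult_assoc_mat[OF r A] by simp
    also have "n \<cdot>\<^sub>m r = r * ?N"
      using mult_smult_distrib[OF r one_carrier_mat] r by simp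
    finally show ?thesis by (simp add: R_act_def)
  qed
  show ?thesis
    unfolding Hom_Lambda_def right_Hom_def
    using maps add act R_act_R(1)[OF _ ij(1,2)] by auto
qed

end

theorem mainTheorem8:
  fixes p :: nat and m :: int and i j :: nat
  assumes "prime p" and "odd p"
    and "ord (int p) m = p - 1"
    and "1 \<le> i" and "i \<le> p - 1" and "1 \<le> j" and "j \<le> p - 1"
  shows "Hom_Lambda p m i j =
    (if i \<ge> j
     then {\<lambda>r\<in>R p i. r * (n \<cdot>\<^sub>m 1\<^sub>m (p - 1)) | n :: int. True}
     else {\<lambda>r\<in>R p i. r * ((int p * n) \<cdot>\<^sub>m 1\<^sub>m (p - 1)) | n :: int. True})"
proof -
  interpret odd_prime_generator p m
    using assms(1-3) by unfold_locales
  note Hom = Hom_Lambda_scalar[OF assms(4-7)] scalar_in_Hom_Lambda[OF assms(4-7)]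
  \<comment> \<open>Both cases are treated as one set with a conditional divisibility; the split
    only rewrites \<open>int p dvd n\<close> as a multiple of p.\<close>
  have "Hom_Lambda p m i j =
      {\<lambda>r\<in>R p i. r * (n \<cdot>\<^sub>m 1\<^sub>m (p - 1)) | n. i < j \<longrightarrow> int p dvd n}"
    using Hom by blast
  also have "\<dots> = (if i \<ge> j
     then {\<lambda>r\<in>R p i. r * (n \<cdot>\<^sub>m 1\<^sub>m (p - 1)) | n :: int. True}
     else {\<lambda>r\<in>R p i. r * ((int p * n) \<cdot>\<^sub>m 1\<^sub>m (p - 1)) | n :: int. True})"
    by (auto elim!: dvdE)
  finally show ?thesis .
qed

end
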